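(* Let $n\ge 1$ and $d>3$, and let $f,g\in\mathbb{C}[x_0,\dots,x_n]$ be two homogeneous polynomials of degree $d$. If $T_f(G\cdot f)=T_g(G\cdot g)$, $V(f)\neq V(g)$ (i.e. $f\notin\mathbb{C}^*g$), and $V(g)$ is smooth, then $g$ is of Sebastiani-Thom type.
   Context: Work over $\mathbb{C}$; $S=\mathbb{C}[x_0,\dots,x_n]$ with its standard grading, and $S_d$ is its degree $d$ component. A homogeneous polynomial of degree $d$ is understood to be nonzero. For a homogeneous polynomial $f\in S$ write $f_i=\partial f/\partial x_i$ and let $J_f=(f_0,\dots,f_n)\subset S$ be the Jacobian ideal. The group $G=GL_{n+1}(\mathbb{C})$ acts on $S_d$ by linear substitutions of the variables, and the tangent space at $f$ to the orbit $G\cdot f$, viewed as a linear subspace of $S_d$, is $T_f(G\cdot f)=J_{f,d}$, the degree $d$ component of $J_f$, i.e. the span of all $x_if_j$, $0\le i,j\le n$. $V(f)\subset\mathbb{P}^n$ is the projective hypersurface $f=0$, taken with its scheme structure (so $V(f)\ne V(g)$ means precisely $f\notin\mathbb{C}^*g$); $V(g)$ is smooth if the partial derivatives of $g$ have no common zero in $\mathbb{P}^n$. A homogeneous polynomial $f$ of degree $d$ is of Sebastiani-Thom type (ST type) if, for some choice of homogeneous (linear) coordinates $(x_0,\dots,x_n)$ of $\mathbb{P}^n$, some $0\le l\le n-1$, and some forms $p,q$, each either zero or homogeneous of degree $d$, one has $f(x_0,\dots,x_n)=p(x_0,\dots,x_l)+q(x_{l+1},\dots,x_n)$. The case $q=0$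 is allowed (then $f$ is called a cone). *)

theory Defs
  imports Complex_Main "HOL-Library.Poly_Mapping" "Jordan_Normal_Form.Matrix"
begin

section \<open>Polynomials in finitely many of the variables $x_0, x_1, \dots$\<close>

text \<open>
  A monomial is a finitely supported exponent vector, a polynomial a finitely supported family of
  coefficients; the ring structure on \<open>cpoly\<close> is that of \<^theory>\<open>HOL-Library.Poly_Mapping\<close>.
  The number of variables is controlled by carrier sets: \<open>polys {..n}\<close> is
  $S = \mathbf{C}[x_0,\dots,x_n]$ and \<open>forms {..n} d\<close> is $S_d$ (which contains $0$).
\<close>

type_synonym mono = "nat \<Rightarrow>\<^sub>0 nat"
type_synonym cpoly = "mono \<Rightarrow>\<^sub>0 complex"

definition mdeg :: "mono \<Rightarrow> nat"
  where "mdeg m = (\<Sum>i\<in>Poly_Mapping.keys m. Poly_Mapping.lookup m i)"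

definition polys :: "nat set \<Rightarrow> cpoly set"
  where "polys V = {f. \<forall>m\<in>Poly_Mapping.keys f. Poly_Mapping.keys m \<subseteq> V}"

definition forms :: "nat set \<Rightarrow> nat \<Rightarrow> cpoly set"
  where "forms V d = {f \<in> polys V. \<forall>m\<in>Poly_Mapping.keys f. mdeg m = d}"

definition homogeneous :: "nat \<Rightarrow> nat \<Rightarrow> cpoly \<Rightarrow> bool"
  where "homogeneous n d f \<longleftrightarrow> f \<in> forms {..n} d \<and> f \<noteq> 0"

definition Const :: "complex \<Rightarrow> cpoly"
  where "Const c = Poly_Mapping.single 0 c"

definition X :: "nat \<Rightarrow> cpoly"
  where "X i = Poly_Mapping.single (Poly_Mapping.single i 1) 1"

definition psmult :: "complex \<Rightarrow> cpoly \<Rightarrow> cpoly"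
  where "psmult c f = Const c * f"

definition pdiff :: "nat \<Rightarrow> cpoly \<Rightarrow> cpoly"
  where "pdiff i f = (\<Sum>m\<in>Poly_Mapping.keys f.
    Poly_Mapping.single (m - Poly_Mapping.single i 1)
      (of_nat (Poly_Mapping.lookup m i) * Poly_Mapping.lookup f m))"

definition peval :: "cpoly \<Rightarrow> (nat \<Rightarrow> complex) \<Rightarrow> complex"
  where "peval f a = (\<Sum>m\<in>Poly_Mapping.keys f.
    Poly_Mapping.lookup f m * (\<Prod>i\<in>Poly_Mapping.keys m. a i ^ Poly_Mapping.lookup m i))"

definition psubst :: "(nat \<Rightarrow> cpoly) \<Rightarrow> cpoly \<Rightarrow> cpoly"
  where "psubst \<sigma> f = (\<Sum>m\<in>Poly_Mapping.keys f.
    Const (Poly_Mapping.lookup f m) * (\<Prod>i\<in>Poly_Mapping.keys m. \<sigma> i ^ Poly_Mapping.lookup m i))"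


section \<open>The hypersurface defined by a form\<close>

text \<open>Equality of $V(f)$ and $V(g)$ as subschemes of projective space.\<close>

definition same_hypersurface :: "cpoly \<Rightarrow> cpoly \<Rightarrow> bool"
  where "same_hypersurface f g \<longleftrightarrow> (\<exists>c. c \<noteq> 0 \<and> f = psmult c g)"

text \<open>
  Points of $\mathbf{P}^n$ are given by their homogeneous coordinates \<open>a 0, \<dots>, a n\<close>, not all zero.
\<close>

definition smooth_hypersurface :: "nat \<Rightarrow> cpoly \<Rightarrow> bool"
  where "smooth_hypersurface n g \<longleftrightarrow>
    \<not> (\<exists>a. (\<exists>i\<le>n. a i \<noteq> 0) \<and> (\<forall>j\<le>n. peval (pdiff j g) a = 0))"


section \<open>Linear substitutions, and forms of Sebastiani-Thom type\<close>

definition GL :: "nat \<Rightarrow> complex mat set"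
  where "GL n = {A \<in> carrier_mat (Suc n) (Suc n). invertible_mat A}"

text \<open>\<open>lin_form A i\<close> is the form $\sum_j A_{ij} x_j$, so \<open>lin_subst A f\<close> is $f(Ax)$.\<close>

definition lin_form :: "complex mat \<Rightarrow> nat \<Rightarrow> cpoly"
  where "lin_form A i = (\<Sum>j<dim_col A. Const (A $$ (i, j)) * X j)"

definition lin_subst :: "complex mat \<Rightarrow> cpoly \<Rightarrow> cpoly"
  where "lin_subst A f = psubst (lin_form A) f"

text \<open>
  The rows of \<open>A\<close> are the new coordinates $y_i = \sum_j A_{ij} x_j$, and the condition reads
  $f = p(y_0,\dots,y_l) + q(y_{l+1},\dots,y_n)$.
\<close>

definition sebastiani_thom :: "nat \<Rightarrow> nat \<Rightarrow> cpoly \<Rightarrow> bool"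
  where "sebastiani_thom n d f \<longleftrightarrow>
    (\<exists>A\<in>GL n. \<exists>l<n. \<exists>p\<in>forms {..l} d. \<exists>q\<in>forms {l<..n} d. f = lin_subst A (p + q))"


section \<open>The tangent space to the orbit\<close>

text \<open>
  The image of the differential at the identity of the orbit map \<open>A \<mapsto> lin_subst A f\<close>,
  \<open>A \<in> GL n\<close>: all velocities \<open>h\<close> at \<open>t = 0\<close> of the curves \<open>t \<mapsto> f((1 + t A) x)\<close>
  with \<open>A\<close> in the Lie algebra of all matrices (\<open>1 + t A\<close> is invertible for small \<open>t\<close>).
  Derivatives of polynomial-valued functions are taken coefficientwise.
\<close>

definition orbit_tangent :: "nat \<Rightarrow> cpoly \<Rightarrow> cpoly set"
  where "orbit_tangent n f = {h. \<exists>A\<in>carrier_mat (Suc n) (Suc n). \<forall>m.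
    ((\<lambda>t. Poly_Mapping.lookup (lin_subst (1\<^sub>m (Suc n) + t \<cdot>\<^sub>m A) f) m)
      has_field_derivative Poly_Mapping.lookup h m) (at 0)}"

definition jacobian_ideal :: "nat \<Rightarrow> cpoly \<Rightarrow> cpoly set"
  where "jacobian_ideal n f = {\<Sum>j\<le>n. a j * pdiff j f | a. \<forall>j\<le>n. a j \<in> polys {..n}}"

text \<open>
  The rest of this theory shows that the tangent space is the degree \<open>d\<close> component of the
  Jacobian ideal, i.e. the span of all $x_i f_j$: see \<open>orbit_tangent_eq_span\<close> and
  \<open>orbit_tangent_eq_jacobian\<close>.
\<close>

interpretation cpoly: vector_space psmult
  by unfold_locales
    (simp_all add: psmult_def Const_def distrib_left distrib_right single_add mult_single
      flip: mult.assoc)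

abbreviation (input) lk where "lk \<equiv> Poly_Mapping.lookup"
abbreviation (input) ks where "ks \<equiv> Poly_Mapping.keys"

lemma finite_splits: "finite {(a, b). a + b = (k :: mono)}"
proof -
  let ?F = "{u. \<forall>x. (x \<in> ks k \<longrightarrow> u x \<in> {..Max (lk k ` ks k)}) \<and> (x \<notin> ks k \<longrightarrow> u x = (0::nat))}"
  have fF: "finite ?F"
    by (rule finite_set_of_finite_funs) auto
  have le: "lk a x \<le> lk (a + b) x" for a b :: mono and x
    by (simp add: lookup_add)
  have in1: "lk a \<in> ?F" if "a + b = k" for a b
  proof -
    have "lk a x \<le> Max (lk k ` ks k)" if "x \<in> ks k" for x
      using le[of a x b] that \<open>a + b = k\<close>
      by (metis (no_types, lifting) Max_ge finite_imageI finite_keys imageI le_trans)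
    moreover have "lk a x = 0" if "x \<notin> ks k" for x
      using le[of a x b] that \<open>a + b = k\<close> by (simp add: in_keys_iff)
    ultimately show ?thesis by auto
  qed
  have "inj (lk :: mono \<Rightarrow> _)"
    by (simp add: inj_on_def lookup_inject)
  then have f1: "finite (lk -` ?F)"
    using fF finite_vimageI by blast
  have "{(a, b). a + b = k} \<subseteq> (lk -` ?F) \<times> (lk -` ?F)"
    using in1 by (auto simp: add.commute) (metis add.commute)+
  then show ?thesis
    using f1 finite_subset by blast
qed

lemma lookup_times:
  "lk (f * g) k = (\<Sum>(a, b)\<in>{(a, b). a + b = k}. lk f a * lk g (b :: mono))" for f g :: cpoly
proof -
  have "lk (f * g) k = (\<Sum>(a, b). lk f a * lk g b when k = a + b)"
    unfolding times_poly_mapping.rep_eq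
    by (rule prod_fun_unfold_prod) simp_all
  also have "\<dots> = (\<Sum>ab\<in>{(a, b). a + b = k}. (\<lambda>(a, b). lk f a * lk g b when k = a + b) ab)"
    by (rule Sum_any.expand_superset[OF finite_splits]) (auto simp: when_def split: if_splits)
  also have "\<dots> = (\<Sum>(a, b)\<in>{(a, b). a + b = k}. lk f a * lk g b)"
    by (rule sum.cong) auto
  finally show ?thesis .
qed

definition vel :: "(complex \<Rightarrow> cpoly) \<Rightarrow> cpoly \<Rightarrow> bool"
  where "vel F h \<longleftrightarrow> (\<forall>m. ((\<lambda>t. lk (F t) m) has_field_derivative lk h m) (at 0))"

lemma vel_unique: "vel F h \<Longrightarrow> vel F k \<Longrightarrow> h = k"
  unfolding vel_def by (auto intro!: poly_mapping_eqI intro: DERIV_unique)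

lemma vel_const: "vel (\<lambda>t. c) 0"
  by (simp add: vel_def)

lemma vel_add: "vel F h \<Longrightarrow> vel G k \<Longrightarrow> vel (\<lambda>t. F t + G t) (h + k)"
  by (auto simp: vel_def lookup_add intro!: DERIV_add)

lemma vel_sum: "(\<And>i. i \<in> I \<Longrightarrow> vel (F i) (h i)) \<Longrightarrow> vel (\<lambda>t. \<Sum>i\<in>I. F i t) (\<Sum>i\<in>I. h i)"
  by (induction I rule: infinite_finite_induct) (auto intro!: vel_const vel_add)

lemma vel_mult: "vel F h \<Longrightarrow> vel G k \<Longrightarrow> vel (\<lambda>t. F t * G t) (h * G 0 + F 0 * k)"
  unfolding vel_def lookup_times lookup_add sum.distrib[symmetric]
  by (auto intro!: DERIV_sum derivative_eq_intros simp: case_prod_unfold)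

lemma vel_cmult: "vel F h \<Longrightarrow> vel (\<lambda>t. c * F t) (c * h)"
  using vel_mult[OF vel_const] by fastforce

lemma vel_power: "vel F h \<Longrightarrow> vel (\<lambda>t. F t ^ k) (of_nat k * F 0 ^ (k - 1) * h)"
proof (induction k)
  case 0
  then show ?case by (simp add: vel_const)
next
  case (Suc k)
  have "vel (\<lambda>t. F t * F t ^ k) (h * F 0 ^ k + F 0 * (of_nat k * F 0 ^ (k - 1) * h))"
    by (rule vel_mult[OF Suc.prems Suc.IH[OF Suc.prems]])
  moreover have "h * F 0 ^ k + F 0 * (of_nat k * F 0 ^ (k - 1) * h) = of_nat (Suc k) * F 0 ^ k * h"
    by (cases k) (simp_all add: algebra_simps)
  ultimately show ?case by simp
qed

lemma vel_prod:
  assumes "finite I" "\<And>i. i \<in> I \<Longrightarrow> vel (F i) (h i)"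
  shows "vel (\<lambda>t. \<Prod>i\<in>I. F i t) (\<Sum>i\<in>I. h i * (\<Prod>j\<in>I - {i}. F j 0))"
  using assms
proof (induction I)
  case empty
  then show ?case by (simp add: vel_const)
next
  case (insert x I)
  have "vel (\<lambda>t. F x t * (\<Prod>i\<in>I. F i t))
    (h x * (\<Prod>i\<in>I. F i 0) + F x 0 * (\<Sum>i\<in>I. h i * (\<Prod>j\<in>I - {i}. F j 0)))"
    using insert by (intro vel_mult) auto
  moreover have "(\<Sum>i\<in>I. h i * (\<Prod>j\<in>insert x I - {i}. F j 0)) =
      F x 0 * (\<Sum>i\<in>I. h i * (\<Prod>j\<in>I - {i}. F j 0))"
    unfolding sum_distrib_left
  proof (rule sum.cong[OF refl])
    fix i assume "i \<in> I"
    then have "insert x I - {i} = insert x (I - {i})" using insert.hyps by auto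
    then show "h i * (\<Prod>j\<in>insert x I - {i}. F j 0) = F x 0 * (h i * (\<Prod>j\<in>I - {i}. F j 0))"
      using insert.hyps by simp
  qed
  ultimately show ?case
    using insert.hyps by simp
qed

lemma X_power: "X i ^ k = Poly_Mapping.single (Poly_Mapping.single i k) 1"
  by (induction k) (simp_all add: X_def mult_single single_add[symmetric])

lemma prod_X:
  "finite I \<Longrightarrow> (\<Prod>i\<in>I. X i ^ e i) = Poly_Mapping.single (\<Sum>i\<in>I. Poly_Mapping.single i (e i)) 1"
  by (induction I rule: finite_induct) (simp_all add: X_power mult_single)

lemma lookup_sum_single:
  "finite I \<Longrightarrow> lk (\<Sum>i\<in>I. Poly_Mapping.single i (e i)) j = (if j \<in> I then e j else 0)"
  by (simp add: lookup_sum lookup_single when_def)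

lemma prod_X_drop:
  assumes "i \<in> ks m"
  shows "X i ^ (lk m i - 1) * (\<Prod>j\<in>ks m - {i}. X j ^ lk m j) =
    Poly_Mapping.single (m - Poly_Mapping.single i 1) 1"
proof -
  define e where "e j = (if j = i then lk m i - 1 else lk m j)" for j
  have "X i ^ (lk m i - 1) * (\<Prod>j\<in>ks m - {i}. X j ^ lk m j) = (\<Prod>j\<in>ks m. X j ^ e j)"
    using prod.remove[OF finite_keys assms, of "\<lambda>j. X j ^ e j"] by (simp add: e_def)
  also have "\<dots> = Poly_Mapping.single (\<Sum>j\<in>ks m. Poly_Mapping.single j (e j)) 1"
    by (rule prod_X) simp
  also have "(\<Sum>j\<in>ks m. Poly_Mapping.single j (e j)) = m - Poly_Mapping.single i 1"
    by (rule poly_mapping_eqI)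
      (auto simp: lookup_sum_single e_def lookup_minus lookup_single when_def in_keys_iff)
  finally show ?thesis .
qed

lemma vel_psubst:
  assumes f: "f \<in> polys {..n}"
  shows "vel (\<lambda>t. psubst (\<lambda>i. X i + Const t * L i) f) (\<Sum>i\<le>n. L i * pdiff i f)"
proof -
  have C: "vel (\<lambda>t. Const t * L i) (L i)" for i
  proof -
    have "vel Const 1"
      by (auto simp: vel_def Const_def lookup_single lookup_one when_def intro!: derivative_eq_intros)
    from vel_mult[OF this vel_const[of "L i"]] show ?thesis
      by (simp add: Const_def)
  qed
  have v: "vel (\<lambda>t. X i + Const t * L i) (L i)" for i
    using vel_add[OF vel_const C] by fastforce
  let ?D = "\<lambda>m i. Poly_Mapping.single (m - Poly_Mapping.single i 1) (of_nat (lk m i) * lk f m) :: cpoly"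
  have "vel (\<lambda>t. psubst (\<lambda>i. X i + Const t * L i) f)
    (\<Sum>m\<in>ks f. Const (lk f m) * (\<Sum>i\<in>ks m. (of_nat (lk m i) * (X i + Const 0 * L i) ^ (lk m i - 1) * L i) *
        (\<Prod>j\<in>ks m - {i}. (X j + Const 0 * L j) ^ lk m j)))"
    unfolding psubst_def by (intro vel_sum vel_cmult vel_prod vel_power v finite_keys)
  also have "(\<Sum>m\<in>ks f. Const (lk f m) * (\<Sum>i\<in>ks m. (of_nat (lk m i) * (X i + Const 0 * L i) ^ (lk m i - 1) * L i) *
        (\<Prod>j\<in>ks m - {i}. (X j + Const 0 * L j) ^ lk m j))) = (\<Sum>m\<in>ks f. \<Sum>i\<le>n. L i * ?D m i)"
  proof (rule sum.cong[OF refl])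
    fix m assume m: "m \<in> ks f"
    have "Const (lk f m) * (\<Sum>i\<in>ks m. (of_nat (lk m i) * (X i + Const 0 * L i) ^ (lk m i - 1) * L i) *
        (\<Prod>j\<in>ks m - {i}. (X j + Const 0 * L j) ^ lk m j)) = (\<Sum>i\<in>ks m. L i * ?D m i)"
      unfolding sum_distrib_left
    proof (rule sum.cong[OF refl])
      fix i assume i: "i \<in> ks m"
      have "Const (lk f m) * ((of_nat (lk m i) * (X i + Const 0 * L i) ^ (lk m i - 1) * L i) *
          (\<Prod>j\<in>ks m - {i}. (X j + Const 0 * L j) ^ lk m j)) =
        L i * (Const (lk f m) * (of_nat (lk m i) * (X i ^ (lk m i - 1) * (\<Prod>j\<in>ks m - {i}. X j ^ lk m j))))"
        by (simp add: Const_def algebra_simps)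
      also have "\<dots> = L i * ?D m i"
        unfolding prod_X_drop[OF i] Const_def single_of_nat[symmetric] mult_single
        by (simp add: mult.commute)
      finally show "Const (lk f m) * ((of_nat (lk m i) * (X i + Const 0 * L i) ^ (lk m i - 1) * L i) *
          (\<Prod>j\<in>ks m - {i}. (X j + Const 0 * L j) ^ lk m j)) = L i * ?D m i" .
    qed
    also have "\<dots> = (\<Sum>i\<le>n. L i * ?D m i)"
      using f m by (intro sum.mono_neutral_left) (auto simp: polys_def in_keys_iff)
    finally show "Const (lk f m) * (\<Sum>i\<in>ks m. (of_nat (lk m i) * (X i + Const 0 * L i) ^ (lk m i - 1) * L i) *
        (\<Prod>j\<in>ks m - {i}. (X j + Const 0 * L j) ^ lk m j)) = (\<Sum>i\<le>n. L i * ?D m i)" .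
  qed
  also have "\<dots> = (\<Sum>i\<le>n. L i * pdiff i f)"
    by (subst sum.swap) (simp add: pdiff_def sum_distrib_left)
  finally show ?thesis .
qed

lemma lin_subst_line:
  assumes f: "f \<in> polys {..n}" and A: "A \<in> carrier_mat (Suc n) (Suc n)"
  shows "lin_subst (1\<^sub>m (Suc n) + t \<cdot>\<^sub>m A) f = psubst (\<lambda>i. X i + Const t * lin_form A i) f"
proof -
  have "lin_form (1\<^sub>m (Suc n) + t \<cdot>\<^sub>m A) i = X i + Const t * lin_form A i" if "i \<le> n" for i
  proof -
    have "lin_form (1\<^sub>m (Suc n) + t \<cdot>\<^sub>m A) i =
      (\<Sum>j<Suc n. (if i = j then X j else 0) + Const t * (Const (A $$ (i, j)) * X j))"
      unfolding lin_form_def using A that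
      by (intro sum.cong) (auto simp: Const_def algebra_simps mult_single single_add)
    also have "\<dots> = X i + Const t * lin_form A i"
      using A that unfolding sum.distrib lin_form_def sum_distrib_left[symmetric] by (simp del: sum.lessThan_Suc)
    finally show ?thesis .
  qed
  moreover have "i \<le> n" if "m \<in> ks f" "i \<in> ks m" for m i
    using f that by (auto simp: polys_def)
  ultimately show ?thesis
    unfolding lin_subst_def psubst_def
    by (intro sum.cong refl arg_cong2[of _ _ _ _ "(*)"] prod.cong) simp
qed

lemma orbit_tangent_eq:
  assumes "f \<in> polys {..n}"
  shows "orbit_tangent n f =
    {\<Sum>i\<le>n. lin_form A i * pdiff i f | A. A \<in> carrier_mat (Suc n) (Suc n)}"
proof -
  have v: "vel (\<lambda>t. lin_subst (1\<^sub>m (Suc n) + t \<cdot>\<^sub>m A) f) (\<Sum>i\<le>n. lin_form A i * pdiff i f)"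
    if "A \<in> carrier_mat (Suc n) (Suc n)" for A
    using vel_psubst[OF assms] by (simp only: lin_subst_line[OF assms that])
  have "orbit_tangent n f = {h. \<exists>A\<in>carrier_mat (Suc n) (Suc n).
      vel (\<lambda>t. lin_subst (1\<^sub>m (Suc n) + t \<cdot>\<^sub>m A) f) h}"
    by (simp add: orbit_tangent_def vel_def)
  then show ?thesis
    using v vel_unique by blast
qed

lemma lin_form_times:
  assumes "A \<in> carrier_mat (Suc n) (Suc n)"
  shows "lin_form A i * g = (\<Sum>j\<le>n. psmult (A $$ (i, j)) (X j * g))"
  using assms by (simp add: lin_form_def psmult_def sum_distrib_right mult.assoc lessThan_Suc_atMost)

theorem orbit_tangent_eq_span:
  assumes "f \<in> polys {..n}"
  shows "orbit_tangent n f = cpoly.span {X i * pdiff j f | i j. i \<le> n \<and> j \<le> n}" (is "?T = cpoly.span ?B")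
proof
  have E: "(\<Sum>i\<le>n. lin_form A i * pdiff i f) = (\<Sum>i\<le>n. \<Sum>j\<le>n. psmult (A $$ (i, j)) (X j * pdiff i f))"
    if "A \<in> carrier_mat (Suc n) (Suc n)" for A
    by (simp only: lin_form_times[OF that])
  have T: "?T = {\<Sum>i\<le>n. \<Sum>j\<le>n. psmult (A $$ (i, j)) (X j * pdiff i f) | A. A \<in> carrier_mat (Suc n) (Suc n)}"
    unfolding orbit_tangent_eq[OF assms]
    by (rule Collect_cong) (use E in \<open>metis (no_types)\<close>)
  show "?T \<subseteq> cpoly.span ?B"
    unfolding T by (auto intro!: cpoly.span_sum cpoly.span_scale intro: cpoly.span_base)
  let ?s = "\<lambda>A. \<Sum>i\<le>n. \<Sum>j\<le>n. psmult (A $$ (i, j)) (X j * pdiff i f)"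
  have mem: "?s A \<in> ?T" if "A \<in> carrier_mat (Suc n) (Suc n)" for A
    unfolding T using that by blast
  have "cpoly.subspace ?T"
  proof (rule cpoly.subspaceI)
    have "?s (0\<^sub>m (Suc n) (Suc n)) = 0"
      by simp
    then show "0 \<in> ?T" using mem[of "0\<^sub>m (Suc n) (Suc n)"] by simp
  next
    fix h k assume "h \<in> ?T" "k \<in> ?T"
    then obtain A B where AB: "A \<in> carrier_mat (Suc n) (Suc n)" "B \<in> carrier_mat (Suc n) (Suc n)"
      and hk: "h = ?s A" "k = ?s B"
      unfolding T by blast
    have "?s (A + B) = h + k"
      unfolding hk sum.distrib[symmetric] using AB
      by (intro sum.cong refl) (simp add: cpoly.scale_left_distrib)
    then show "h + k \<in> ?T" using mem[of "A + B"] AB by simp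
  next
    fix c h assume "h \<in> ?T"
    then obtain A where A: "A \<in> carrier_mat (Suc n) (Suc n)" and h: "h = ?s A"
      unfolding T by blast
    have "?s (c \<cdot>\<^sub>m A) = psmult c h"
      unfolding h cpoly.scale_sum_right using A
      by (intro sum.cong refl) simp
    then show "psmult c h \<in> ?T" using mem[of "c \<cdot>\<^sub>m A"] A by simp
  qed
  moreover have "?B \<subseteq> ?T"
  proof clarify
    fix i j assume ij: "i \<le> n" "j \<le> n"
    let ?E = "mat (Suc n) (Suc n) (\<lambda>(r, s). if r = j \<and> s = i then 1 else (0::complex))"
    have "?s ?E = (\<Sum>r\<le>n. \<Sum>s\<le>n. if s = i then (if r = j then X s * pdiff r f else 0) else 0)"
      by (intro sum.cong refl) auto
    also have "\<dots> = X i * pdiff j f"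
      using ij by (simp add: sum.delta)
    finally show "X i * pdiff j f \<in> ?T" using mem[of ?E] by simp
  qed
  ultimately show "cpoly.span ?B \<subseteq> ?T"
    by (simp add: cpoly.span_minimal)
qed

lemma mdeg_superset: "finite I \<Longrightarrow> ks m \<subseteq> I \<Longrightarrow> mdeg m = (\<Sum>i\<in>I. lk m i)"
  unfolding mdeg_def by (rule sum.mono_neutral_left) (auto simp: in_keys_iff)

lemma mdeg_add: "mdeg (a + b) = mdeg a + mdeg b"
proof -
  have "ks (a + b) \<subseteq> ks a \<union> ks b" by (rule keys_add)
  then show ?thesis
    by (simp add: mdeg_superset[of "ks a \<union> ks b"] lookup_add sum.distrib)
qed

lemma mdeg_single [simp]: "mdeg (Poly_Mapping.single i k) = k"
  by (simp add: mdeg_def)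

lemma mdeg_minus_single:
  assumes "i \<in> ks m" shows "mdeg (m - Poly_Mapping.single i 1) = mdeg m - 1"
proof -
  have "m - Poly_Mapping.single i 1 + Poly_Mapping.single i 1 = m"
    using assms
    by (intro poly_mapping_eqI) (auto simp: lookup_add lookup_minus lookup_single when_def in_keys_iff)
  then show ?thesis
    by (metis add_diff_cancel_right' mdeg_add mdeg_single)
qed

lemma forms_iff: "f \<in> forms V d \<longleftrightarrow> (\<forall>m. lk f m \<noteq> 0 \<longrightarrow> ks m \<subseteq> V \<and> mdeg m = d)"
  by (auto simp: forms_def polys_def in_keys_iff)

lemma pdiff_forms:
  assumes f: "f \<in> forms V d" shows "pdiff i f \<in> forms V (d - 1)"
  unfolding forms_iff
proof (intro allI impI)
  fix k assume "lk (pdiff i f) k \<noteq> 0"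
  then obtain m where "m \<in> ks f"
    "lk (Poly_Mapping.single (m - Poly_Mapping.single i 1) (of_nat (lk m i) * lk f m)) k \<noteq> 0"
    unfolding pdiff_def lookup_sum by (rule sum.not_neutral_contains_not_neutral)
  then have m: "m \<in> ks f" "k = m - Poly_Mapping.single i 1" "lk m i \<noteq> 0"
    by (auto simp: lookup_single when_def split: if_splits)
  moreover have "ks k \<subseteq> ks m"
    unfolding m(2) by (auto simp: in_keys_iff lookup_minus)
  moreover have "mdeg k = mdeg m - 1"
    unfolding m(2) using m(3) by (intro mdeg_minus_single) (simp add: in_keys_iff)
  ultimately show "ks k \<subseteq> V \<and> mdeg k = d - 1"
    using f unfolding forms_def polys_def by auto
qed

lemma times_forms:
  assumes f: "f \<in> forms V d" and g: "g \<in> forms V e" shows "f * g \<in> forms V (d + e)"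
  unfolding forms_iff
proof (intro allI impI)
  fix k assume "lk (f * g) k \<noteq> 0"
  then obtain ab where "ab \<in> {(a, b). a + b = k}" "(case ab of (a, b) \<Rightarrow> lk f a * lk g b) \<noteq> 0"
    unfolding lookup_times by (rule sum.not_neutral_contains_not_neutral)
  then obtain a b where "a + b = k" "lk f a \<noteq> 0" "lk g b \<noteq> 0"
    by (cases ab) auto
  then show "ks k \<subseteq> V \<and> mdeg k = d + e"
    using f g keys_add[of a b] unfolding forms_iff by (metis Un_least mdeg_add subset_trans)
qed

lemma subspace_forms: "cpoly.subspace (forms V d)"
proof (rule cpoly.subspaceI)
  show "0 \<in> forms V d" by (simp add: forms_iff)
  show "f + g \<in> forms V d" if fg: "f \<in> forms V d" "g \<in> forms V d" for f g
    unfolding forms_iff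
  proof (intro allI impI)
    fix m assume "lk (f + g) m \<noteq> 0"
    then show "ks m \<subseteq> V \<and> mdeg m = d"
      using fg by (cases "lk f m = 0") (simp_all add: forms_iff lookup_add)
  qed
  show "psmult c f \<in> forms V d" if "f \<in> forms V d" for c f
  proof -
    have "Const c \<in> forms V 0"
      by (simp add: forms_iff Const_def lookup_single when_def mdeg_def)
    from times_forms[OF this that] show ?thesis
      by (simp add: psmult_def)
  qed
qed

definition lin_part :: "cpoly \<Rightarrow> cpoly"
  where "lin_part a = (\<Sum>m\<in>{m \<in> ks a. mdeg m = 1}. Poly_Mapping.single m (lk a m))"

lemma lookup_lin_part: "lk (lin_part a) m = (if mdeg m = 1 then lk a m else 0)"
  by (auto simp: lin_part_def lookup_sum lookup_single when_def in_keys_iff)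

lemma lin_part_eq:
  assumes "a \<in> polys {..n}"
  shows "lin_part a = (\<Sum>i\<le>n. psmult (lk a (Poly_Mapping.single i 1)) (X i))"
proof (rule poly_mapping_eqI)
  fix m
  have R: "lk (\<Sum>i\<le>n. psmult (lk a (Poly_Mapping.single i 1)) (X i)) m =
      (\<Sum>i\<le>n. if Poly_Mapping.single i 1 = m then lk a m else 0)"
    unfolding lookup_sum psmult_def Const_def X_def mult_single
    by (intro sum.cong) (auto simp: lookup_single when_def)
  show "lk (lin_part a) m = lk (\<Sum>i\<le>n. psmult (lk a (Poly_Mapping.single i 1)) (X i)) m"
  proof (cases "\<exists>i. m = Poly_Mapping.single i 1")
    case True
    then obtain i where i: "m = Poly_Mapping.single i 1" by blast
    have eq: "(Poly_Mapping.single j 1 = m) = (j = i)" for j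
      unfolding i by (metis keys_single singleton_inject zero_neq_one)
    have "lk a m = 0" if "\<not> i \<le> n"
    proof (rule ccontr)
      assume "lk a m \<noteq> 0"
      then have "ks m \<subseteq> {..n}"
        using assms unfolding polys_def by (simp add: in_keys_iff)
      then show False using that unfolding i by simp
    qed
    moreover have "mdeg m = 1"
      unfolding i by simp
    ultimately show ?thesis
      unfolding R lookup_lin_part by (simp only: eq) simp
  next
    case False
    have "mdeg m \<noteq> 1"
    proof
      assume "mdeg m = 1"
      then have "(\<Sum>i\<in>ks m. lk m i) = Suc 0" by (simp add: mdeg_def)
      then obtain i where i: "i \<in> ks m" "lk m i = Suc 0" "\<forall>j\<in>ks m. i \<noteq> j \<longrightarrow> lk m j = 0"
        by (auto simp: sum_eq_Suc0_iff)
      then have "m = Poly_Mapping.single i 1"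
        by (intro poly_mapping_eqI) (auto simp: lookup_single when_def in_keys_iff)
      with False show False by blast
    qed
    moreover have "Poly_Mapping.single i 1 \<noteq> m" for i using False by blast
    ultimately show ?thesis
      unfolding R lookup_lin_part by simp
  qed
qed

lemma lookup_times_lin_part:
  assumes g: "g \<in> forms V e"
  shows "lk (lin_part a * g) m = (if mdeg m = Suc e then lk (a * g) m else 0)"
proof (cases "mdeg m = Suc e")
  case True
  have "lk (lin_part a) p * lk g q = lk a p * lk g q" if "p + q = m" for p q
    using True g mdeg_add[of p q] that by (cases "lk g q = 0") (auto simp: lookup_lin_part forms_iff)
  then show ?thesis
    using True unfolding lookup_times by (auto intro!: sum.cong)
next
  case False
  have "lk (lin_part a) p * lk g q = 0" if "p + q = m" for p q
    using False g mdeg_add[of p q] that by (cases "lk g q = 0") (auto simp: lookup_lin_part forms_iff)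
  then show ?thesis
    using False unfolding lookup_times by (auto intro!: sum.neutral)
qed

theorem orbit_tangent_eq_jacobian:
  assumes f: "f \<in> forms {..n} d" and d: "d \<ge> 1"
  shows "orbit_tangent n f = jacobian_ideal n f \<inter> forms {..n} d"
proof
  have fp: "f \<in> polys {..n}" using f by (simp add: forms_def)
  have pd: "pdiff i f \<in> forms {..n} (d - 1)" for i by (rule pdiff_forms[OF f])
  have X: "X i \<in> forms {..n} 1" if "i \<le> n" for i
    using that by (auto simp: forms_iff X_def lookup_single when_def split: if_splits)
  have "orbit_tangent n f \<subseteq> forms {..n} d"
    unfolding orbit_tangent_eq_span[OF fp]
    using times_forms[OF X pd] d by (intro cpoly.span_minimal subspace_forms) auto
  moreover have "orbit_tangent n f \<subseteq> jacobian_ideal n f"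
  proof -
    have "lin_form A i \<in> polys {..n}" if A: "A \<in> carrier_mat (Suc n) (Suc n)" for A i
    proof -
      have "lin_form A i = (\<Sum>j\<le>n. psmult (A $$ (i, j)) (X j))"
        using lin_form_times[OF A, of i 1] by simp
      also have "\<dots> \<in> forms {..n} 1"
        using X by (intro cpoly.subspace_sum subspace_forms cpoly.subspace_scale) auto
      finally show ?thesis by (simp add: forms_def)
    qed
    then show ?thesis
      unfolding orbit_tangent_eq[OF fp] jacobian_ideal_def by blast
  qed
  ultimately show "orbit_tangent n f \<subseteq> jacobian_ideal n f \<inter> forms {..n} d" by blast
  show "jacobian_ideal n f \<inter> forms {..n} d \<subseteq> orbit_tangent n f"
  proof
    fix h assume h: "h \<in> jacobian_ideal n f \<inter> forms {..n} d"
    then obtain a where a: "\<And>j. j \<le> n \<Longrightarrow> a j \<in> polys {..n}" and ha: "h = (\<Sum>j\<le>n. a j * pdiff j f)"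
      unfolding jacobian_ideal_def by blast
    have "h = (\<Sum>j\<le>n. lin_part (a j) * pdiff j f)"
    proof (rule poly_mapping_eqI)
      fix m
      have "lk (\<Sum>j\<le>n. lin_part (a j) * pdiff j f) m = (if mdeg m = d then lk h m else 0)"
        unfolding lookup_sum lookup_times_lin_part[OF pd] ha using d by simp
      then show "lk h m = lk (\<Sum>j\<le>n. lin_part (a j) * pdiff j f) m"
        using h by (auto simp: forms_iff)
    qed
    also have "\<dots> = (\<Sum>j\<le>n. \<Sum>i\<le>n. psmult (lk (a j) (Poly_Mapping.single i 1)) (X i * pdiff j f))"
      by (intro sum.cong refl)
        (simp add: lin_part_eq[OF a] sum_distrib_right psmult_def mult.assoc)
    also have "\<dots> \<in> orbit_tangent n f"
      unfolding orbit_tangent_eq_span[OF fp]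
      by (auto intro!: cpoly.span_sum cpoly.span_scale intro: cpoly.span_base)
    finally show "h \<in> orbit_tangent n f" .
  qed
qed

end

theory Submission
  imports Defs "HOL-Analysis.Continuum_Not_Denumerable"
    "Jordan_Normal_Form.Jordan_Normal_Form_Existence"
begin

text \<open>
  Since $V(g)$ is smooth, the partials $g_0,\dots,g_n$ form a regular sequence (Nullstellensatz and
  Koszul complex), so they have no nontrivial syzygies of degree below $d - 1$, in particular no
  quadratic ones. This turns the equality of the tangent spaces into $f_j = \sum_k M_{jk} g_k$ with a
  constant matrix $M$. Choose coordinates in which $M^T$ is in Jordan form $J$, so that
  $f_j = \sum_i J_{ij} g_i$. If $J$ has a block of size at least two, comparing mixed second partials of $f$
  gives $g_{ii} = 0$ for some $i$, which makes the $i$-th coordinate point singular on $V(g)$. So $J$ is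
  diagonal, with at least two different eigenvalues because $f \notin \mathbf{C}^* g$, and
  $J_{jj} g_{ij} = f_{ij} = J_{ii} g_{ij}$ separates the variables of $g$ by eigenvalue.
\<close>

text \<open>Regularity of the partials themselves is awkward to check, so it is replaced by
  exactness of their Koszul complex in degree one. For this it suffices that the ideal (g_0, ...,
  g_n) contains some regular sequence of length n + 1, and pure powers x_i^N serve: they lie in the
  ideal because the g_k vanish together only at the origin, and their regularity is a comparison of
  exponents. Exactness puts the coefficients of any syzygy into the ideal, which is generated in
  degree d - 1. The syzygies that occur are quadratic because a relation for x_0 f_j and one for x_1
  f_j, both with linear coefficients, are multiplied crosswise by x_1 and x_0; so 2 < d - 1 is
  exactly the bound d > 3. The Nullstellensatz rests on cardinality: over the uncountable field of
  complex numbers, an algebra of countable dimension cannot contain inverses of all x - z without a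
  linear relation among them. The matrix is transposed before its Jordan form is taken because the
  chain rule acts on gradients by the transpose of the coordinate change.\<close>

section \<open>The Koszul complex\<close>

text \<open>For a ring acting on itself, \<open>ideal.span B\<close> is the ideal generated by \<open>B\<close>.\<close>

interpretation ideal: Modules.module "(*) :: 'a::comm_ring_1 \<Rightarrow> 'a \<Rightarrow> 'a"
  by unfold_locales (simp_all add: algebra_simps)

declare ideal.scale_scale [simp del] \<comment> \<open>reassociates products, against \<open>mult.assoc\<close>\<close>

text \<open>
  An element of the Koszul complex of $g_0,\dots,g_{m-1}$ is the family of its coordinates in the
  basis $e_A$, $A \subseteq \{0,\dots,m-1\}$, of the exterior algebra.
\<close>

definition koszul_sign :: "nat \<Rightarrow> nat set \<Rightarrow> 'a::comm_ring_1"
  where "koszul_sign k A = (- 1) ^ card {a \<in> A. a < k}"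

text \<open>Contraction of the exterior algebra with the functional sending e_k to g_k: the
  coordinate at A collects the basis elements that become e_A on losing one factor e_k. The sign
  counts the factors that e_k passes on its way to the front.\<close>

definition koszul_bd :: "(nat \<Rightarrow> 'a) \<Rightarrow> nat \<Rightarrow> (nat set \<Rightarrow> 'a::comm_ring_1) \<Rightarrow> nat set \<Rightarrow> 'a"
  where "koszul_bd g m w A = (\<Sum>k\<in>{..<m} - A. koszul_sign k A * g k * w (insert k A))"

text \<open>Left exterior multiplication by the element of degree one with coordinates c_k, which
  serves as the homotopy.\<close>

definition koszul_wedge :: "(nat \<Rightarrow> 'a) \<Rightarrow> (nat set \<Rightarrow> 'a::comm_ring_1) \<Rightarrow> nat set \<Rightarrow> 'a"
  where "koszul_wedge c z A = (\<Sum>k\<in>A. koszul_sign k A * c k * z (A - {k}))"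

lemma koszul_sign_sq: "koszul_sign k A * koszul_sign k A = (1 :: 'a::comm_ring_1)"
  by (simp add: koszul_sign_def flip: power_add mult_2)

lemma koszul_sign_insert:
  assumes "finite A" "k \<notin> A"
  shows "koszul_sign l (insert k A) = (if k < l then - koszul_sign l A else koszul_sign l A :: 'a::comm_ring_1)"
proof (cases "k < l")
  case True
  then have "{a \<in> insert k A. a < l} = insert k {a \<in> A. a < l}" by auto
  then show ?thesis using assms True by (simp add: koszul_sign_def)
next
  case False
  then have "{a \<in> insert k A. a < l} = {a \<in> A. a < l}" by auto
  then show ?thesis using False by (simp add: koszul_sign_def)
qed

lemma koszul_bd_linear:
  "koszul_bd g m (\<lambda>A. w A - v A - u A * c) A
    = koszul_bd g m w A - koszul_bd g m v A - koszul_bd g m u A * (c :: 'a::comm_ring_1)"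
  unfolding koszul_bd_def sum_subtractf[symmetric] sum_distrib_right
  by (intro sum.cong refl) (simp only: right_diff_distrib mult.assoc)

text \<open>Each pair of indices k, l outside A occurs in both orders. Inserting the smaller index
  flips the sign of the larger one but not conversely, so the two terms cancel.\<close>

lemma koszul_bd_bd:
  fixes w :: "nat set \<Rightarrow> 'a::comm_ring_1"
  assumes "finite A"
  shows "koszul_bd g m (koszul_bd g m w) A = 0"
proof -
  let ?M = "{..<m} - A"
  define F where "F k l = koszul_sign k A * g k * (koszul_sign l (insert k A) * g l * w (insert l (insert k A)))"
    for k l
  have anti: "F k l + F l k = 0" if "k \<in> ?M" "l \<in> ?M" "k < l" for k l
  proof -
    have "koszul_sign l (insert k A) = (- koszul_sign l A :: 'a)" "koszul_sign k (insert l A) = (koszul_sign k A :: 'a)"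
      using that assms by (simp_all add: koszul_sign_insert)
    then have "koszul_sign k A * koszul_sign l (insert k A) + koszul_sign l A * koszul_sign k (insert l A) = (0 :: 'a)"
      by (simp add: mult.commute)
    moreover have "F k l + F l k
      = (koszul_sign k A * koszul_sign l (insert k A) + koszul_sign l A * koszul_sign k (insert l A))
        * (g k * g l * w (insert k (insert l A)))"
      unfolding F_def insert_commute[of l k A] by (simp only: distrib_left distrib_right mult_ac)
    ultimately show ?thesis by simp
  qed
  have "koszul_bd g m (koszul_bd g m w) A = (\<Sum>k\<in>?M. \<Sum>l\<in>?M - {k}. F k l)"
    unfolding koszul_bd_def[of g m "koszul_bd g m w"]
  proof (rule sum.cong[OF refl])
    fix k
    have "{..<m} - insert k A = ?M - {k}" by auto
    then show "koszul_sign k A * g k * koszul_bd g m w (insert k A) = (\<Sum>l\<in>?M - {k}. F k l)"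
      by (simp only: koszul_bd_def F_def sum_distrib_left)
  qed
  also have "\<dots> = (\<Sum>k\<in>?M. \<Sum>l\<in>?M. (if k < l then F k l else 0) + (if l < k then F k l else 0))"
  proof (rule sum.cong[OF refl])
    fix k assume k: "k \<in> ?M"
    show "(\<Sum>l\<in>?M - {k}. F k l) = (\<Sum>l\<in>?M. (if k < l then F k l else 0) + (if l < k then F k l else 0))"
    proof -
      have "(\<Sum>l\<in>?M - {k}. F k l) = (\<Sum>l\<in>?M - {k}. (if k < l then F k l else 0) + (if l < k then F k l else 0))"
      proof (rule sum.cong[OF refl])
        fix l assume "l \<in> ?M - {k}"
        then have "k < l \<or> l < k" by auto
        then show "F k l = (if k < l then F k l else 0) + (if l < k then F k l else 0)"
          by (elim disjE) simp_all
      qed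
      also have "\<dots> = (\<Sum>l\<in>?M. (if k < l then F k l else 0) + (if l < k then F k l else 0))"
        using k by (subst sum.remove[of ?M k]) simp_all
      finally show ?thesis .
    qed
  qed
  also have "\<dots> = (\<Sum>k\<in>?M. \<Sum>l\<in>?M. if k < l then F k l else 0) + (\<Sum>l\<in>?M. \<Sum>k\<in>?M. if l < k then F k l else 0)"
    unfolding sum.distrib by (subst (4) sum.swap) (rule refl)
  also have "\<dots> = (\<Sum>k\<in>?M. \<Sum>l\<in>?M. if k < l then F k l + F l k else 0)"
    unfolding sum.distrib[symmetric] by (intro sum.cong refl) simp
  also have "\<dots> = 0"
    using anti by (intro sum.neutral ballI) auto
  finally show ?thesis .
qed

text \<open>Contraction is an antiderivation: the mixed terms of the two composites cancel, while
  the diagonal ones run over the k outside A in the first and over the k in A in the second. Hence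
  every element of the ideal of the g_k acts as zero on Koszul homology.\<close>

lemma koszul_homotopy:
  fixes z :: "nat set \<Rightarrow> 'a::comm_ring_1"
  assumes A: "A \<subseteq> {..<m}"
  shows "koszul_bd g m (koszul_wedge c z) A + koszul_wedge c (koszul_bd g m z) A
    = (\<Sum>k<m. c k * g k) * z A"
proof -
  let ?M = "{..<m} - A"
  have fin: "finite A" using A finite_subset by blast
  define E where "E k l = koszul_sign k A * g k * (koszul_sign l (insert k A) * c l * z (insert k A - {l}))"
    for k l
  have 1: "koszul_bd g m (koszul_wedge c z) A = (\<Sum>k\<in>?M. c k * g k * z A) + (\<Sum>k\<in>?M. \<Sum>l\<in>A. E k l)"
    unfolding koszul_bd_def sum.distrib[symmetric]
  proof (rule sum.cong[OF refl])
    fix k assume k: "k \<in> ?M"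
    have "koszul_sign k A * g k * (koszul_sign k A * c k * z A)
      = (koszul_sign k A * koszul_sign k A) * (c k * g k * z A)"
      by (simp only: mult_ac)
    then show "koszul_sign k A * g k * koszul_wedge c z (insert k A) = c k * g k * z A + (\<Sum>l\<in>A. E k l)"
      using fin k
      by (simp add: koszul_wedge_def E_def distrib_left sum_distrib_left koszul_sign_insert koszul_sign_sq)
  qed
  have 2: "koszul_wedge c (koszul_bd g m z) A = (\<Sum>l\<in>A. c l * g l * z A) - (\<Sum>l\<in>A. \<Sum>k\<in>?M. E k l)"
    unfolding koszul_wedge_def sum_subtractf[symmetric]
  proof (rule sum.cong[OF refl])
    fix l assume l: "l \<in> A"
    let ?B = "A - {l}"
    have B: "finite ?B" "l \<notin> ?B" "insert l ?B = A" using fin l by auto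
    have s: "koszul_sign k A = (if l < k then - koszul_sign k ?B else koszul_sign k ?B :: 'a)" for k
      using koszul_sign_insert[OF B(1,2), of k] unfolding B(3) .
    have M: "{..<m} - ?B = insert l ?M" using A l by auto
    have "koszul_sign l A = (koszul_sign l ?B :: 'a)"
      by (simp only: s less_irrefl if_False)
    then have "koszul_sign l A * c l * (koszul_sign l ?B * g l * z (insert l ?B))
      = (koszul_sign l ?B * koszul_sign l ?B) * (c l * g l * z A)"
      by (simp only: B(3) mult_ac)
    then have d: "koszul_sign l A * c l * (koszul_sign l ?B * g l * z (insert l ?B)) = c l * g l * z A"
      by (simp only: koszul_sign_sq mult_1_left)
    have e: "koszul_sign l A * c l * (koszul_sign k ?B * g k * z (insert k ?B)) = - E k l" if k: "k \<in> ?M" for k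
    proof -
      have kl: "k \<noteq> l" "k \<notin> A" "insert k A - {l} = insert k ?B" using k l by auto
      have "koszul_sign k A * koszul_sign l (insert k A) = - (koszul_sign l A * koszul_sign k ?B :: 'a)"
        using kl(1) s[of k] koszul_sign_insert[OF fin kl(2), of l, where 'a='a]
        by (cases "k < l") auto
      moreover have "E k l = (koszul_sign k A * koszul_sign l (insert k A)) * (g k * c l * z (insert k ?B))"
        unfolding E_def kl(3) by (simp only: mult_ac)
      moreover have "koszul_sign l A * c l * (koszul_sign k ?B * g k * z (insert k ?B))
          = (koszul_sign l A * koszul_sign k ?B) * (g k * c l * z (insert k ?B))"
        by (simp only: mult_ac)
      ultimately show ?thesis by simp
    qed
    show "koszul_sign l A * c l * koszul_bd g m z ?B = c l * g l * z A - (\<Sum>k\<in>?M. E k l)"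
    proof -
      have "koszul_sign l A * c l * koszul_bd g m z ?B
        = koszul_sign l A * c l * (koszul_sign l ?B * g l * z (insert l ?B))
          + (\<Sum>k\<in>?M. koszul_sign l A * c l * (koszul_sign k ?B * g k * z (insert k ?B)))"
        unfolding koszul_bd_def M using l by (simp add: distrib_left sum_distrib_left)
      also have "\<dots> = c l * g l * z A + (\<Sum>k\<in>?M. - E k l)"
        unfolding d using e by simp
      finally show ?thesis by (simp add: sum_negf)
    qed
  qed
  have "(\<Sum>k<m. c k * g k) * z A = (\<Sum>k\<in>?M. c k * g k * z A) + (\<Sum>l\<in>A. c l * g l * z A)"
    unfolding sum_distrib_right using A by (intro sum.subset_diff) auto
  then show ?thesis
    unfolding 1 2 using sum.swap[of E A ?M] by simp
qed

lemma koszul_bd_mem_ideal: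
  assumes "\<And>k. k < m \<Longrightarrow> k \<notin> A \<Longrightarrow> w (insert k A) \<in> ideal.span B"
  shows "koszul_bd g m w A \<in> ideal.span B"
  unfolding koszul_bd_def using assms by (intro ideal.span_sum ideal.span_scale) auto

text \<open>
  Each $a_j$ lies in the ideal of the $g_k$, so it kills Koszul homology; being regular, it embeds the
  homology modulo $a_0,\dots,a_{j-1}$ into the homology modulo $a_0,\dots,a_j$, one degree higher.
  Above degree $m$ there is nothing.
\<close>

lemma koszul_acyclic_mod:
  fixes g a :: "nat \<Rightarrow> 'a::comm_ring_1"
  assumes mem: "\<And>j. j < m \<Longrightarrow> \<exists>c. a j = (\<Sum>k<m. c k * g k)"
    and reg: "\<And>j h. j < m \<Longrightarrow> a j * h \<in> ideal.span (a ` {..<j}) \<Longrightarrow> h \<in> ideal.span (a ` {..<j})"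
    and "j \<le> m" "j < i"
    and "\<And>A. A \<subseteq> {..<m} \<Longrightarrow> Suc (card A) = i \<Longrightarrow> koszul_bd g m z A \<in> ideal.span (a ` {..<j})"
  shows "\<exists>w. \<forall>A. A \<subseteq> {..<m} \<longrightarrow> card A = i \<longrightarrow> z A - koszul_bd g m w A \<in> ideal.span (a ` {..<j})"
  using assms(3-5)
proof (induction j arbitrary: i z rule: inc_induct)
  case base
  have "\<not> (A \<subseteq> {..<m} \<and> card A = i)" for A
    using base.prems(1) card_mono[of "{..<m}" A] by auto
  then show ?case by blast
next
  case (step j)
  let ?I = "ideal.span (a ` {..<j})"
  have I: "ideal.span (a ` {..<Suc j}) = {x. \<exists>u. x - u * a j \<in> ?I}"
    by (simp add: lessThan_Suc ideal.span_insert)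
  obtain c where c: "a j = (\<Sum>k<m. c k * g k)" using mem step.hyps by blast
  define w where "w = koszul_wedge c z"
  have w: "a j * z A - koszul_bd g m w A \<in> ?I" if A: "A \<subseteq> {..<m}" "card A = i" for A
  proof -
    have "koszul_wedge c (koszul_bd g m z) A \<in> ?I"
      unfolding koszul_wedge_def
    proof (intro ideal.span_sum ideal.span_scale step.prems(2))
      fix k assume "k \<in> A"
      then show "A - {k} \<subseteq> {..<m}" "Suc (card (A - {k})) = i"
        using A finite_subset[of A "{..<m}"] card_Suc_Diff1[of A k] by auto
    qed
    moreover have "a j * z A = koszul_bd g m w A + koszul_wedge c (koszul_bd g m z) A"
      using koszul_homotopy[OF A(1), of g c z] unfolding c w_def by (rule sym)
    ultimately show ?thesis by simp
  qed
  have "koszul_bd g m w A \<in> ideal.span (a ` {..<Suc j})" if A: "A \<subseteq> {..<m}" "Suc (card A) = Suc i" for A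
  proof -
    have "koszul_bd g m w A - z A * a j \<in> ?I"
      using ideal.span_neg[OF w[of A]] A by (simp add: mult.commute)
    then show ?thesis unfolding I by blast
  qed
  then obtain v where
    v: "\<And>A. A \<subseteq> {..<m} \<Longrightarrow> card A = Suc i \<Longrightarrow> w A - koszul_bd g m v A \<in> ideal.span (a ` {..<Suc j})"
    using step.IH[of "Suc i" w] step.prems(1) by auto
  then have "\<exists>u. A \<subseteq> {..<m} \<and> card A = Suc i \<longrightarrow> w A - koszul_bd g m v A - u * a j \<in> ?I" for A
    unfolding I by blast
  then obtain u where
    u: "\<And>A. A \<subseteq> {..<m} \<Longrightarrow> card A = Suc i \<Longrightarrow> w A - koszul_bd g m v A - u A * a j \<in> ?I"
    by metis
  have "z A - koszul_bd g m u A \<in> ?I" if A: "A \<subseteq> {..<m}" "card A = i" for A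
  proof -
    have fin: "finite A" using A(1) finite_subset by blast
    \<comment> \<open>Apply the boundary to w = bd v + a_j u: the term bd (bd v) drops out, so
      modulo the ideal bd w equals a_j bd u, and by the homotopy it also equals a_j z.\<close>
    have "koszul_bd g m (\<lambda>A. w A - koszul_bd g m v A - u A * a j) A \<in> ?I"
      using A fin by (intro koszul_bd_mem_ideal u) auto
    also have "koszul_bd g m (\<lambda>A. w A - koszul_bd g m v A - u A * a j) A
        = koszul_bd g m w A - koszul_bd g m (koszul_bd g m v) A - koszul_bd g m u A * a j"
      by (rule koszul_bd_linear)
    finally have "koszul_bd g m w A - koszul_bd g m u A * a j \<in> ?I"
      by (simp add: koszul_bd_bd[OF fin])
    from ideal.span_add[OF w[OF A] this] have "a j * (z A - koszul_bd g m u A) \<in> ?I"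
      by (simp add: algebra_simps)
    then show ?thesis using reg step.hyps by blast
  qed
  then show ?case by blast
qed

text \<open>In degree one and with nothing divided out, acyclicity says that every syzygy of
  \<open>g\<close> is a combination of the trivial ones g_l e_k - g_k e_l. Regularity is demanded of
  \<open>a\<close>, a sequence of the same length inside the ideal of \<open>g\<close>.\<close>

lemma syzygy_in_ideal:
  fixes g a q :: "nat \<Rightarrow> 'a::comm_ring_1"
  assumes mem: "\<And>j. j < m \<Longrightarrow> a j \<in> ideal.span (g ` {..<m})"
    and reg: "\<And>j h. j < m \<Longrightarrow> a j * h \<in> ideal.span (a ` {..<j}) \<Longrightarrow> h \<in> ideal.span (a ` {..<j})"
    and syz: "(\<Sum>k<m. q k * g k) = 0" and "k < m"
  shows "q k \<in> ideal.span (g ` {..<m})"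
proof -
  have "\<exists>c. h = (\<Sum>k<m. c k * g k)" if "h \<in> ideal.span (g ` {..<m})" for h
    using that
  proof (induction rule: ideal.span_induct_alt)
    case base
    show ?case by (intro exI[of _ "\<lambda>_. 0"]) simp
  next
    case (step b x y)
    then obtain c i where c: "y = (\<Sum>k<m. c k * g k)" and i: "i < m" "x = g i" by auto
    have "b * x + y = (\<Sum>k<m. ((if k = i then b else 0) + c k) * g k)"
      unfolding c distrib_right sum.distrib using i
      by (simp add: if_distrib[of "\<lambda>x. x * _"] cong: if_cong)
    then show ?case
      by (intro exI[of _ "\<lambda>k. (if k = i then b else 0) + c k"])
  qed
  then have mem': "\<exists>c. a j = (\<Sum>k<m. c k * g k)" if "j < m" for j
    using mem that by blast
  \<comment> \<open>Only the values on singletons matter; the sum is a convenient total function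
    with \<open>z {k} = q k\<close>.\<close>
  define z where "z A = (\<Sum>k\<in>A. q k)" for A
  have base: "koszul_bd g m z A \<in> ideal.span (a ` {..<0})" if "A \<subseteq> {..<m}" "Suc (card A) = 1" for A
  proof -
    have "A = {}" using that finite_subset[of A "{..<m}"] by simp
    then show ?thesis using syz by (simp add: koszul_bd_def z_def koszul_sign_def mult.commute)
  qed
  have "\<exists>w. \<forall>A. A \<subseteq> {..<m} \<longrightarrow> card A = 1 \<longrightarrow> z A - koszul_bd g m w A \<in> ideal.span (a ` {..<0})"
  proof (rule koszul_acyclic_mod)
    show "\<exists>c. a j = (\<Sum>k<m. c k * g k)" if "j < m" for j by (rule mem'[OF that])
    show "h \<in> ideal.span (a ` {..<j})" if "j < m" "a j * h \<in> ideal.span (a ` {..<j})" for j h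
      by (rule reg[OF that])
    show "0 \<le> m" "0 < (1::nat)" by simp_all
    show "koszul_bd g m z A \<in> ideal.span (a ` {..<0})" if "A \<subseteq> {..<m}" "Suc (card A) = 1" for A
      by (rule base[OF that])
  qed
  then obtain w where
    "\<And>A. A \<subseteq> {..<m} \<Longrightarrow> card A = 1 \<Longrightarrow> z A - koszul_bd g m w A \<in> ideal.span (a ` {..<0})"
    by blast
  from this[of "{k}"] have "z {k} - koszul_bd g m w {k} \<in> {0}" using \<open>k < m\<close> by simp
  then have "q k = koszul_bd g m w {k}" by (simp add: z_def)
  also have "\<dots> = (\<Sum>l\<in>{..<m} - {k}. koszul_sign l {k} * w {l, k} * g l)"
    unfolding koszul_bd_def by (intro sum.cong refl) (simp only: mult_ac)
  also have "\<dots> \<in> ideal.span (g ` {..<m})"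
    by (intro ideal.span_sum ideal.span_scale ideal.span_base) auto
  finally show ?thesis .
qed

section \<open>Evaluation and differentiation\<close>

lemma lookup_pdiff:
  "lk (pdiff i f) m = of_nat (lk m i + 1) * lk f (m + Poly_Mapping.single i 1)"
proof -
  let ?e = "Poly_Mapping.single i (1 :: nat)"
  have "lk (pdiff i f) m = (\<Sum>k\<in>ks f. if k = m + ?e then of_nat (lk m i + 1) * lk f k else 0)"
    unfolding pdiff_def lookup_sum
  proof (rule sum.cong[OF refl])
    fix k
    show "lk (Poly_Mapping.single (k - ?e) (of_nat (lk k i) * lk f k)) m
      = (if k = m + ?e then of_nat (lk m i + 1) * lk f k else 0)"
    proof (cases "lk k i = 0")
      case True
      then have "k \<noteq> m + ?e" by (auto simp: lookup_add)
      with True show ?thesis by simp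
    next
      case False
      then have "k - ?e + ?e = k"
        by (intro poly_mapping_eqI) (auto simp: lookup_add lookup_minus lookup_single when_def)
      then have "k - ?e = m \<longleftrightarrow> k = m + ?e" by (metis add_diff_cancel_right')
      then show ?thesis by (auto simp: lookup_single when_def lookup_add)
    qed
  qed
  then show ?thesis by (simp add: in_keys_iff)
qed

lemma pdiff_0 [simp]: "pdiff i 0 = 0"
  by (simp add: pdiff_def)

lemma pdiff_add: "pdiff i (f + g) = pdiff i f + pdiff i g"
  by (rule poly_mapping_eqI) (simp only: lookup_pdiff lookup_add distrib_left)

lemma pdiff_sum: "pdiff i (\<Sum>a\<in>A. f a) = (\<Sum>a\<in>A. pdiff i (f a))"
  by (induction A rule: infinite_finite_induct) (simp_all add: pdiff_add)

lemma pdiff_commute: "pdiff i (pdiff j f) = pdiff j (pdiff i f)"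
proof (rule poly_mapping_eqI)
  fix m
  let ?e = "\<lambda>i. Poly_Mapping.single i (1 :: nat)"
  have "of_nat (lk m i + 1) * of_nat (lk (m + ?e i) j + 1)
    = (of_nat (lk m j + 1) * of_nat (lk (m + ?e j) i + 1) :: complex)"
    by (cases "i = j") (simp_all add: lookup_add lookup_single)
  then show "lk (pdiff i (pdiff j f)) m = lk (pdiff j (pdiff i f)) m"
    unfolding lookup_pdiff mult.assoc[symmetric] by (simp only: add.assoc add.commute[of "?e i"])
qed

lemma pdiff_single:
  "pdiff i (Poly_Mapping.single m c) = Poly_Mapping.single (m - Poly_Mapping.single i 1) (of_nat (lk m i) * c)"
  by (cases "c = 0") (simp_all add: pdiff_def)

lemma pdiff_Const [simp]: "pdiff i (Const c) = 0"
  by (simp add: Const_def pdiff_single)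

lemma pdiff_X: "pdiff i (X j) = (if i = j then 1 else 0)"
  unfolding X_def pdiff_single by (simp add: lookup_single when_def)

lemma sum_singles: "(\<Sum>m\<in>ks f. Poly_Mapping.single m (lk f m)) = f"
  by (rule poly_mapping_eqI) (simp add: lookup_sum lookup_single when_def in_keys_iff)

lemma pdiff_mult: "pdiff i (f * g) = pdiff i f * g + f * pdiff i g"
proof -
  let ?e = "Poly_Mapping.single i (1 :: nat)"
  \<comment> \<open>Subtraction of exponents is truncated, so the shift needs \<open>lk m i\<close>
    to be nonzero; otherwise the factor \<open>of_nat (lk m i)\<close> makes both sides
    vanish.\<close>
  have shift: "m + n - ?e = (m - ?e) + n" if "lk m i \<noteq> 0" for m n
    using that by (intro poly_mapping_eqI) (auto simp: lookup_add lookup_minus lookup_single when_def)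
  have mono: "pdiff i (Poly_Mapping.single m c * Poly_Mapping.single n d)
    = pdiff i (Poly_Mapping.single m c) * Poly_Mapping.single n d
      + Poly_Mapping.single m c * pdiff i (Poly_Mapping.single n d)" for m n :: mono and c d
  proof -
    have "of_nat (lk m i + lk n i) * (c * d) = of_nat (lk m i) * c * d + c * (of_nat (lk n i) * d)"
      by (simp add: algebra_simps)
    then have "pdiff i (Poly_Mapping.single m c * Poly_Mapping.single n d)
      = Poly_Mapping.single (m + n - ?e) (of_nat (lk m i) * c * d)
        + Poly_Mapping.single (m + n - ?e) (c * (of_nat (lk n i) * d))"
      unfolding mult_single pdiff_single lookup_add by (simp only: single_add)
    moreover have "Poly_Mapping.single (m + n - ?e) (of_nat (lk m i) * c * d)
        = Poly_Mapping.single ((m - ?e) + n) (of_nat (lk m i) * c * d)"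
      using shift[of m n] by (cases "lk m i = 0") simp_all
    moreover have "Poly_Mapping.single (m + n - ?e) (c * (of_nat (lk n i) * d))
        = Poly_Mapping.single (m + (n - ?e)) (c * (of_nat (lk n i) * d))"
      using shift[of n m] by (cases "lk n i = 0") (simp_all add: add.commute)
    ultimately show ?thesis
      unfolding pdiff_single mult_single by simp
  qed
  let ?s = "\<lambda>f m. Poly_Mapping.single m (lk f m)"
  have "pdiff i ((\<Sum>m\<in>ks f. ?s f m) * (\<Sum>n\<in>ks g. ?s g n))
    = pdiff i (\<Sum>m\<in>ks f. ?s f m) * (\<Sum>n\<in>ks g. ?s g n) + (\<Sum>m\<in>ks f. ?s f m) * pdiff i (\<Sum>n\<in>ks g. ?s g n)"
    unfolding sum_product pdiff_sum mono sum.distrib ..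
  then show ?thesis by (simp only: sum_singles)
qed

section \<open>Constants, and evaluation as a ring homomorphism\<close>

lemma Const_0: "Const 0 = 0"
  and Const_1: "Const 1 = 1"
  and Const_uminus: "Const (- c) = - Const c"
  and Const_add: "Const (c + d) = Const c + Const d"
  and Const_mult: "Const (c * d) = Const c * Const d"
  by (simp_all add: Const_def single_add mult_single single_uminus)

lemma comm_ring_hom_Const: "comm_ring_hom Const"
  by unfold_locales (simp_all add: Const_0 Const_1 Const_add Const_mult)

lemma comm_ring_hom_id: "comm_ring_hom (\<lambda>c. c)"
  by unfold_locales simp_all

text \<open>Common generalization of \<open>psubst\<close> (with \<open>Const\<close> for \<phi>)
  and \<open>peval\<close> (with the identity), so that the homomorphism laws are proved once for
  both.\<close>

definition poly_eval :: "(complex \<Rightarrow> 'a) \<Rightarrow> (nat \<Rightarrow> 'a) \<Rightarrow> cpoly \<Rightarrow> 'a::comm_ring_1"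
  where "poly_eval \<phi> \<sigma> f = (\<Sum>m\<in>ks f. \<phi> (lk f m) * (\<Prod>i\<in>ks m. \<sigma> i ^ lk m i))"

lemma psubst_eq_poly_eval: "psubst \<sigma> = poly_eval Const \<sigma>"
  by (rule ext) (simp add: psubst_def poly_eval_def)

lemma peval_eq_poly_eval: "peval f a = poly_eval (\<lambda>c. c) a f"
  by (simp add: peval_def poly_eval_def)

lemma poly_eval_cong:
  assumes "f \<in> polys V" "\<And>i. i \<in> V \<Longrightarrow> \<sigma> i = \<tau> i"
  shows "poly_eval \<phi> \<sigma> f = poly_eval \<phi> \<tau> f"
proof -
  have "\<sigma> i = \<tau> i" if "m \<in> ks f" "i \<in> ks m" for m i
    using assms that unfolding polys_def by blast
  then show ?thesis
    unfolding poly_eval_def by (intro sum.cong refl arg_cong2[where f="(*)"] prod.cong) simp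
qed

context
  fixes \<phi> :: "complex \<Rightarrow> 'a::comm_ring_1"
  assumes \<phi>: "comm_ring_hom \<phi>"
begin

interpretation \<phi>: comm_ring_hom \<phi> by (rule \<phi>)

lemma poly_eval_superset:
  "finite A \<Longrightarrow> ks f \<subseteq> A \<Longrightarrow> poly_eval \<phi> \<sigma> f = (\<Sum>m\<in>A. \<phi> (lk f m) * (\<Prod>i\<in>ks m. \<sigma> i ^ lk m i))"
  unfolding poly_eval_def by (rule sum.mono_neutral_left) (auto simp: in_keys_iff)

lemma poly_eval_add: "poly_eval \<phi> \<sigma> (f + g) = poly_eval \<phi> \<sigma> f + poly_eval \<phi> \<sigma> g"
proof -
  have "ks (f + g) \<subseteq> ks f \<union> ks g" by (rule keys_add)
  then show ?thesis
    by (simp add: poly_eval_superset[of "ks f \<union> ks g"] lookup_add \<phi>.hom_add distrib_right sum.distrib)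
qed

lemma poly_eval_0: "poly_eval \<phi> \<sigma> 0 = 0"
  by (simp add: poly_eval_def)

lemma poly_eval_sum: "poly_eval \<phi> \<sigma> (\<Sum>a\<in>A. f a) = (\<Sum>a\<in>A. poly_eval \<phi> \<sigma> (f a))"
  by (induction A rule: infinite_finite_induct) (simp_all add: poly_eval_add poly_eval_0)

lemma poly_eval_single:
  "finite A \<Longrightarrow> ks m \<subseteq> A \<Longrightarrow>
    poly_eval \<phi> \<sigma> (Poly_Mapping.single m c) = \<phi> c * (\<Prod>i\<in>A. \<sigma> i ^ lk m i)"
proof -
  assume "finite A" "ks m \<subseteq> A"
  then have "(\<Prod>i\<in>A. \<sigma> i ^ lk m i) = (\<Prod>i\<in>ks m. \<sigma> i ^ lk m i)"
    by (intro prod.mono_neutral_right) (auto simp: in_keys_iff)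
  then show ?thesis
    by (simp add: poly_eval_superset[of "{m}"])
qed

lemma poly_eval_Const: "poly_eval \<phi> \<sigma> (Const c) = \<phi> c"
  unfolding Const_def by (subst poly_eval_single[of "{}"]) simp_all

lemma poly_eval_X: "poly_eval \<phi> \<sigma> (X i) = \<sigma> i"
  unfolding X_def by (subst poly_eval_single[of "{i}"]) simp_all

lemma poly_eval_mult: "poly_eval \<phi> \<sigma> (f * g) = poly_eval \<phi> \<sigma> f * poly_eval \<phi> \<sigma> g"
proof -
  have mono: "poly_eval \<phi> \<sigma> (Poly_Mapping.single m c * Poly_Mapping.single n d)
    = poly_eval \<phi> \<sigma> (Poly_Mapping.single m c) * poly_eval \<phi> \<sigma> (Poly_Mapping.single n d)" for m n c d
  proof -
    let ?A = "ks m \<union> ks n"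
    have "ks (m + n) \<subseteq> ?A" by (rule keys_add)
    then have "poly_eval \<phi> \<sigma> (Poly_Mapping.single m c * Poly_Mapping.single n d)
      = (\<phi> c * \<phi> d) * ((\<Prod>i\<in>?A. \<sigma> i ^ lk m i) * (\<Prod>i\<in>?A. \<sigma> i ^ lk n i))"
      by (simp add: mult_single poly_eval_single[of ?A] \<phi>.hom_mult lookup_add power_add prod.distrib)
    also have "\<dots> = poly_eval \<phi> \<sigma> (Poly_Mapping.single m c) * poly_eval \<phi> \<sigma> (Poly_Mapping.single n d)"
      by (subst (1 2) poly_eval_single[of ?A]) (simp_all only: finite_Un finite_keys Un_upper1 Un_upper2 mult_ac simp_thms)
    finally show ?thesis .
  qed
  let ?s = "\<lambda>f m. Poly_Mapping.single m (lk f m)"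
  have "poly_eval \<phi> \<sigma> ((\<Sum>m\<in>ks f. ?s f m) * (\<Sum>n\<in>ks g. ?s g n))
    = poly_eval \<phi> \<sigma> (\<Sum>m\<in>ks f. ?s f m) * poly_eval \<phi> \<sigma> (\<Sum>n\<in>ks g. ?s g n)"
    unfolding sum_product poly_eval_sum mono ..
  then show ?thesis by (simp only: sum_singles)
qed

end

text \<open>Induction along ring generators: identities between homomorphisms or derivations need
  checking only on constants and variables.\<close>

lemma polys_induct [consumes 1, case_names Const X add mult]:
  assumes f: "f \<in> polys V"
    and C: "\<And>c. P (Const c)"
    and X: "\<And>i. i \<in> V \<Longrightarrow> P (X i)"
    and add: "\<And>f g. P f \<Longrightarrow> P g \<Longrightarrow> P (f + g)"
    and mult: "\<And>f g. P f \<Longrightarrow> P g \<Longrightarrow> P (f * g)"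
  shows "P f"
proof -
  have 01: "P 0" "P 1"
    using C[of 0] C[of 1] by (simp_all add: Const_def)
  have sum: "P (\<Sum>a\<in>A. h a)" if "\<And>a. a \<in> A \<Longrightarrow> P (h a)" for A :: "mono set" and h
    using that by (induction A rule: infinite_finite_induct) (auto intro: add 01)
  have pow: "P (X i ^ k)" if "i \<in> V" for i k
    using that by (induction k) (auto intro: mult X 01)
  have prod: "P (\<Prod>a\<in>A. h a)" if "\<And>a. a \<in> A \<Longrightarrow> P (h a)" for A :: "nat set" and h
    using that by (induction A rule: infinite_finite_induct) (auto intro: mult 01)
  have "Const (lk f m) * (\<Prod>i\<in>ks m. X i ^ lk m i) = Poly_Mapping.single m (lk f m)" for m
  proof -
    have "(\<Sum>i\<in>ks m. Poly_Mapping.single i (lk m i)) = m"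
      by (rule poly_mapping_eqI) (simp add: lookup_sum_single in_keys_iff)
    then show ?thesis by (simp add: prod_X Const_def mult_single)
  qed
  then have "f = (\<Sum>m\<in>ks f. Const (lk f m) * (\<Prod>i\<in>ks m. X i ^ lk m i))"
    by (simp add: sum_singles)
  also have "P \<dots>"
    using f by (intro sum mult C prod pow) (auto simp: polys_def)
  finally show ?thesis .
qed

lemmas psubst_simps = poly_eval_add[OF comm_ring_hom_Const, folded psubst_eq_poly_eval]
  poly_eval_mult[OF comm_ring_hom_Const, folded psubst_eq_poly_eval]
  poly_eval_Const[OF comm_ring_hom_Const, folded psubst_eq_poly_eval]
  poly_eval_X[OF comm_ring_hom_Const, folded psubst_eq_poly_eval]

lemmas psubst_sum = poly_eval_sum[OF comm_ring_hom_Const, folded psubst_eq_poly_eval]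

lemma psubst_0 [simp]: "psubst \<sigma> 0 = 0" and psubst_1 [simp]: "psubst \<sigma> 1 = 1"
  using psubst_simps(3)[of \<sigma> 0] psubst_simps(3)[of \<sigma> 1] by (simp_all add: Const_def)

lemmas peval_simps = poly_eval_add[OF comm_ring_hom_id, folded peval_eq_poly_eval]
  poly_eval_mult[OF comm_ring_hom_id, folded peval_eq_poly_eval]
  poly_eval_Const[OF comm_ring_hom_id, folded peval_eq_poly_eval]
  poly_eval_X[OF comm_ring_hom_id, folded peval_eq_poly_eval]

lemmas peval_sum = poly_eval_sum[OF comm_ring_hom_id, folded peval_eq_poly_eval]

lemma polys_UNIV [simp]: "f \<in> polys UNIV"
  by (simp add: polys_def)

lemma psubst_psubst: "psubst \<tau> (psubst \<sigma> f) = psubst (\<lambda>i. psubst \<tau> (\<sigma> i)) f"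
  by (rule polys_induct[of f UNIV]) (simp_all add: psubst_simps)

lemma peval_psubst: "peval (psubst \<sigma> f) a = peval f (\<lambda>i. peval (\<sigma> i) a)"
  by (rule polys_induct[of f UNIV]) (simp_all add: psubst_simps peval_simps)

lemma psubst_X [simp]: "psubst X f = f"
  by (rule polys_induct[of f UNIV]) (simp_all add: psubst_simps)

lemmas psubst_cong = poly_eval_cong[where \<phi>=Const, folded psubst_eq_poly_eval]

text \<open>Chain rule. Both sides are additive and satisfy the product rule over
  \<open>psubst \<sigma>\<close>, so agreement on constants and variables suffices.\<close>

lemma pdiff_psubst:
  assumes "f \<in> polys V" "finite V"
  shows "pdiff i (psubst \<sigma> f) = (\<Sum>k\<in>V. pdiff i (\<sigma> k) * psubst \<sigma> (pdiff k f))"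
  using assms(1)
proof (induction rule: polys_induct)
  case (X j)
  then have "(\<Sum>k\<in>V. pdiff i (\<sigma> k) * psubst \<sigma> (pdiff k (X j))) = (\<Sum>k\<in>V. if k = j then pdiff i (\<sigma> k) else 0)"
    by (intro sum.cong) (auto simp: pdiff_X)
  then show ?case using X assms(2) by (simp add: psubst_simps)
next
  case (add f g)
  then show ?case by (simp add: psubst_simps pdiff_add distrib_left sum.distrib)
next
  case (mult f g)
  have "(\<Sum>k\<in>V. pdiff i (\<sigma> k) * psubst \<sigma> (pdiff k (f * g)))
    = (\<Sum>k\<in>V. pdiff i (\<sigma> k) * psubst \<sigma> (pdiff k f) * psubst \<sigma> g + psubst \<sigma> f * (pdiff i (\<sigma> k) * psubst \<sigma> (pdiff k g)))"
    by (intro sum.cong refl) (simp only: psubst_simps pdiff_mult distrib_left mult_ac)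
  also have "\<dots> = pdiff i (psubst \<sigma> f) * psubst \<sigma> g + psubst \<sigma> f * pdiff i (psubst \<sigma> g)"
    unfolding mult.IH sum.distrib sum_distrib_left sum_distrib_right ..
  finally show ?case by (simp add: psubst_simps pdiff_mult)
qed (simp add: psubst_simps)

lemma forms_sum: "(\<And>a. a \<in> A \<Longrightarrow> f a \<in> forms V d) \<Longrightarrow> (\<Sum>a\<in>A. f a) \<in> forms V d"
  by (rule cpoly.subspace_sum[OF subspace_forms])

lemma Const_forms: "Const c \<in> forms V 0"
  by (simp add: forms_iff Const_def lookup_single when_def mdeg_def)

lemma X_forms: "i \<in> V \<Longrightarrow> X i \<in> forms V 1"
  by (auto simp: forms_iff X_def lookup_single when_def split: if_splits)

lemma Const_times_forms: "f \<in> forms V d \<Longrightarrow> Const c * f \<in> forms V d"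
  using times_forms[OF Const_forms] by force

lemma lin_form_forms: "A \<in> carrier_mat (Suc n) (Suc n) \<Longrightarrow> lin_form A i \<in> forms {..n} 1"
  unfolding lin_form_def by (intro forms_sum Const_times_forms X_forms) auto

lemma psubst_forms:
  assumes f: "f \<in> forms V d" and \<sigma>: "\<And>i. i \<in> V \<Longrightarrow> \<sigma> i \<in> forms W 1"
  shows "psubst \<sigma> f \<in> forms W d"
  unfolding psubst_def
proof (intro forms_sum Const_times_forms)
  fix m assume m: "m \<in> ks f"
  have pow: "\<sigma> i ^ k \<in> forms W k" if "i \<in> V" for i k
  proof (induction k)
    case 0
    show ?case using Const_forms[of 1] by (simp add: Const_def)
  next
    case (Suc k)
    then show ?case using times_forms[OF \<sigma>[OF that] Suc] by simp
  qed
  have "(\<Prod>i\<in>A. \<sigma> i ^ lk m i) \<in> forms W (\<Sum>i\<in>A. lk m i)" if "finite A" "A \<subseteq> V" for A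
    using that
  proof (induction A)
    case empty
    show ?case using Const_forms[of 1] by (simp add: Const_def)
  next
    case (insert i A)
    then show ?case using times_forms[OF pow] by simp
  qed
  from this[OF finite_keys, of m] show "(\<Prod>i\<in>ks m. \<sigma> i ^ lk m i) \<in> forms W d"
    using f m by (auto simp: forms_def polys_def mdeg_def)
qed

section \<open>The Nullstellensatz and syzygies of low degree\<close>

lemma finite_bounded_monos: "finite {k :: mono. ks k \<subseteq> {..m} \<and> (\<forall>i. lk k i \<le> m)}"
proof -
  let ?F = "{u. \<forall>x. (x \<in> {..m} \<longrightarrow> u x \<in> {..m}) \<and> (x \<notin> {..m} \<longrightarrow> u x = (0::nat))}"
  have "finite ?F"
    by (rule finite_set_of_finite_funs) auto
  moreover have "inj (lk :: mono \<Rightarrow> _)"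
    by (simp add: inj_on_def lookup_inject)
  ultimately have "finite ((lk :: mono \<Rightarrow> _) -` ?F)"
    by (rule finite_vimageI)
  moreover have "{k :: mono. ks k \<subseteq> {..m} \<and> (\<forall>i. lk k i \<le> m)} \<subseteq> lk -` ?F"
    by (auto simp: in_keys_iff subset_iff)
  ultimately show ?thesis by (rule rev_finite_subset)
qed

text \<open>A single bound on indices and exponents exhausts the polynomials by a sequence of
  finite-dimensional subspaces; this is what makes the dimension countable.\<close>

lemma bounded_keys: "\<exists>m. \<forall>k\<in>ks (f :: cpoly). ks k \<subseteq> {..m} \<and> (\<forall>i. lk k i \<le> m)"
proof -
  define b where "b k = (\<Sum>i\<in>ks k. i + lk k i)" for k :: mono
  define m where "m = (\<Sum>k\<in>ks f. b k)"
  have b: "i + lk k i \<le> b k" if "i \<in> ks k" for i k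
    unfolding b_def by (rule member_le_sum[OF that]) simp_all
  have m: "b k \<le> m" if "k \<in> ks f" for k
    unfolding m_def by (rule member_le_sum[OF that]) simp_all
  have "ks k \<subseteq> {..m} \<and> (\<forall>i. lk k i \<le> m)" if k: "k \<in> ks f" for k
  proof (intro conjI allI subsetI)
    show "i \<in> {..m}" if "i \<in> ks k" for i
      using b[OF that] m[OF k] by auto
    show "lk k i \<le> m" for i
      using b[of i k] m[OF k] by (cases "i \<in> ks k") (auto simp: in_keys_iff)
  qed
  then show ?thesis by blast
qed

text \<open>The polynomials form a vector space of countable dimension, while \<open>\<complex>\<close> is uncountable.\<close>

lemma complex_family_dependent:
  fixes u :: "complex \<Rightarrow> cpoly"
  obtains F c where "finite F" "(\<Sum>z\<in>F. Const (c z) * u z) = 0" "\<exists>z\<in>F. c z \<noteq> 0"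
proof -
  define M where "M m = {k :: mono. ks k \<subseteq> {..m} \<and> (\<forall>i. lk k i \<le> m)}" for m
  have finM: "finite (M m)" for m
    unfolding M_def by (rule finite_bounded_monos)
  \<comment> \<open>Otherwise countably many finite sets would cover the complex numbers.\<close>
  have "\<exists>m. infinite {z. ks (u z) \<subseteq> M m}"
  proof (rule ccontr)
    assume "\<not> ?thesis"
    then have "countable (\<Union>m. {z. ks (u z) \<subseteq> M m})"
      by (intro countable_UN) (auto intro: countable_finite)
    moreover have "(\<Union>m. {z. ks (u z) \<subseteq> M m}) = UNIV"
    proof (rule UNIV_eq_I[symmetric])
      fix z
      obtain m where "\<forall>k\<in>ks (u z). ks k \<subseteq> {..m} \<and> (\<forall>i. lk k i \<le> m)"
        using bounded_keys by blast
      then have "ks (u z) \<subseteq> M m" by (auto simp: M_def)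
      then show "z \<in> (\<Union>m. {z. ks (u z) \<subseteq> M m})" by blast
    qed
    ultimately show False by (metis uncountable_UNIV_complex)
  qed
  then obtain m where "infinite {z. ks (u z) \<subseteq> M m}" by blast
  \<comment> \<open>One vector more than the dimension of the space spanned by the monomials in
    \<open>M m\<close>.\<close>
  then obtain F where F: "finite F" "card F = Suc (card (M m))" "F \<subseteq> {z. ks (u z) \<subseteq> M m}"
    by (meson infinite_arbitrarily_large)
  show ?thesis
  proof (cases "inj_on u F")
    case True
    let ?S = "(\<lambda>k. Poly_Mapping.single k (1 :: complex)) ` M m"
    have "f \<in> cpoly.span ?S" if "ks f \<subseteq> M m" for f
    proof -
      have "(\<Sum>k\<in>ks f. psmult (lk f k) (Poly_Mapping.single k 1)) \<in> cpoly.span ?S"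
        using that by (intro cpoly.span_sum cpoly.span_scale cpoly.span_base) auto
      then show ?thesis
        by (simp add: psmult_def Const_def mult_single sum_singles)
    qed
    then have "u ` F \<subseteq> cpoly.span ?S" using F(3) by blast
    moreover have "card (u ` F) > card ?S"
      using card_image[OF True] F(2) card_image_le[OF finM[of m], of "\<lambda>k. Poly_Mapping.single k (1 :: complex)"]
      by linarith
    moreover have "finite ?S" using finM by simp
    ultimately have "cpoly.dependent (u ` F)"
      using cpoly.independent_span_bound[of ?S "u ` F"] by (meson leD)
    then obtain c where c: "\<exists>v\<in>u ` F. c v \<noteq> 0" "(\<Sum>v\<in>u ` F. psmult (c v) v) = 0"
      using cpoly.dependent_finite[of "u ` F"] F(1) by blast
    show ?thesis
      using F(1) c by (intro that[of F "\<lambda>z. c (u z)"]) (auto simp: sum.reindex[OF True] psmult_def)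
  next
    case False
    \<comment> \<open>Dependence of the image set would miss repeated values; a repetition gives the
      relation u y - u z = 0 directly.\<close>
    then obtain y z where yz: "y \<noteq> z" "u y = u z" unfolding inj_on_def by blast
    then show ?thesis
      by (intro that[of "{y, z}" "\<lambda>w. if w = y then 1 else - 1"]) (auto simp: Const_1 Const_uminus)
  qed
qed

lemma poly_map_Const:
  "poly (map_poly Const 0) x = 0"
  "poly (map_poly Const 1) x = 1"
  "poly (map_poly Const (p + q)) x = poly (map_poly Const p) x + poly (map_poly Const q) x"
  "poly (map_poly Const (p * q)) x = poly (map_poly Const p) x * poly (map_poly Const q) x"
  "poly (map_poly Const [:c:]) x = Const c"
  "poly (map_poly Const [:- c, 1:]) x = x - Const c"
proof -
  interpret map_poly_comm_ring_hom Const
    using comm_ring_hom_Const by (simp add: map_poly_comm_ring_hom_def)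
  show "poly (map_poly Const 0) x = 0"
    "poly (map_poly Const 1) x = 1"
    "poly (map_poly Const (p + q)) x = poly (map_poly Const p) x + poly (map_poly Const q) x"
    "poly (map_poly Const (p * q)) x = poly (map_poly Const p) x * poly (map_poly Const q) x"
    "poly (map_poly Const [:c:]) x = Const c"
    "poly (map_poly Const [:- c, 1:]) x = x - Const c"
    by (simp_all add: hom_distribs)
qed

text \<open>Modulo the ideal every x - z has the inverse \<open>u z\<close>, so the linear factors
  of p can be cancelled one at a time until a nonzero constant is left.\<close>

lemma unit_in_ideal_of_roots:
  fixes p :: "complex poly"
  assumes inv: "\<And>z. 1 - u z * (x - Const z) \<in> ideal.span B"
    and "p \<noteq> 0" "poly (map_poly Const p) x \<in> ideal.span B"
  shows "1 \<in> ideal.span B"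
  using assms(2-3)
proof (induction "degree p" arbitrary: p)
  case 0
  then obtain a where a: "p = [:a:]" using degree_eq_zeroE by metis
  then have "Const (inverse a) * Const a \<in> ideal.span B" "a \<noteq> 0"
    using 0 by (auto intro!: ideal.span_scale simp: poly_map_Const)
  then show ?case by (simp add: Const_def mult_single)
next
  case (Suc k)
  have "\<not> constant (poly p)" using Suc.hyps(2) by (simp add: constant_degree)
  then obtain z where "poly p z = 0" using fundamental_theorem_of_algebra by blast
  then obtain q where q: "p = [:- z, 1:] * q" by (auto simp: poly_eq_0_iff_dvd dvd_def)
  have nz: "q \<noteq> 0" using Suc.prems(1) q by auto
  have deg: "degree q = k" using Suc.hyps(2) nz unfolding q by (subst (asm) degree_mult_eq) auto
  have eq: "poly (map_poly Const p) x = (x - Const z) * poly (map_poly Const q) x"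
    unfolding q by (simp only: poly_map_Const)
  have "poly (map_poly Const q) x
    = poly (map_poly Const q) x * (1 - u z * (x - Const z)) + u z * poly (map_poly Const p) x"
    unfolding eq by (simp add: algebra_simps)
  also have "\<dots> \<in> ideal.span B"
    using inv Suc.prems(2) by (intro ideal.span_add ideal.span_scale) auto
  finally show ?case using Suc.hyps(1)[OF deg[symmetric]] nz by blast
qed

text \<open>If every z failed, all x - z would have inverses \<open>u z\<close> modulo the ideal. A
  linear relation between finitely many of these, multiplied by the product of the x - z, becomes a
  nonzero polynomial in x lying in the ideal, and cancelling its roots puts 1 there.\<close>

lemma exists_proper_specialization:
  assumes proper: "1 \<notin> ideal.span B"
  shows "\<exists>z. 1 \<notin> ideal.span (insert (x - Const z) B)"
proof (rule ccontr)
  assume "\<not> ?thesis"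
  then have "\<exists>u. 1 - u * (x - Const z) \<in> ideal.span B" for z
    by (simp add: ideal.span_insert)
  then obtain u where u: "\<And>z. 1 - u z * (x - Const z) \<in> ideal.span B" by metis
  obtain F c where F: "finite F" "(\<Sum>z\<in>F. Const (c z) * u z) = 0" "\<exists>z\<in>F. c z \<noteq> 0"
    by (rule complex_family_dependent)
  define h where "h p = poly (map_poly Const p) x" for p
  have h_sum: "h (\<Sum>z\<in>A. f z) = (\<Sum>z\<in>A. h (f z))" for A :: "complex set" and f
    by (induction A rule: infinite_finite_induct) (simp_all add: h_def poly_map_Const)
  have h_prod: "h (\<Prod>z\<in>A. [:- z, 1:]) = (\<Prod>z\<in>A. x - Const z)" for A
    by (induction A rule: infinite_finite_induct)
      (simp_all add: h_def poly_map_Const Const_1 Const_uminus del: mult_pCons_left)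
  \<comment> \<open>Numerator of the sum of c_z / (t - z) over z in F. At z0 only the summand of z0
    survives, which shows that p is nonzero.\<close>
  define p where "p = (\<Sum>z\<in>F. [:c z:] * (\<Prod>w\<in>F - {z}. [:- w, 1:]))"
  have "p \<noteq> 0"
  proof -
    obtain z0 where z0: "z0 \<in> F" "c z0 \<noteq> 0" using F(3) by blast
    have "poly p z0 = (\<Sum>z\<in>F. if z = z0 then c z * (\<Prod>w\<in>F - {z}. z0 - w) else 0)"
      unfolding p_def poly_sum
    proof (rule sum.cong[OF refl])
      fix z
      have "(\<Prod>w\<in>F - {z}. z0 - w) = 0" if "z \<noteq> z0"
        using F(1) z0 that by (intro prod_zero) auto
      then show "poly ([:c z:] * (\<Prod>w\<in>F - {z}. [:- w, 1:])) z0
        = (if z = z0 then c z * (\<Prod>w\<in>F - {z}. z0 - w) else 0)"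
        by (simp add: poly_prod)
    qed
    then have "poly p z0 \<noteq> 0"
      using F(1) z0 by simp
    then show ?thesis by auto
  qed
  moreover have "h p \<in> ideal.span B"
  proof -
    let ?Q = "\<lambda>A. \<Prod>w\<in>A. x - Const w"
    have "h p = (\<Sum>z\<in>F. Const (c z) * ?Q (F - {z}))"
      unfolding p_def h_sum h_prod[symmetric]
      by (simp only: h_def poly_map_Const)
    \<comment> \<open>Split 1 as (1 - u_z (x - z)) + u_z (x - z); the second parts add up to the
      linear relation times the full product, hence to 0.\<close>
    also have "\<dots> = (\<Sum>z\<in>F. (Const (c z) * ?Q (F - {z})) * (1 - u z * (x - Const z)) + Const (c z) * u z * ?Q F)"
    proof (rule sum.cong[OF refl])
      fix z assume "z \<in> F"
      then have "?Q F = (x - Const z) * ?Q (F - {z})" using F(1) by (rule prod.remove[rotated])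
      then show "Const (c z) * ?Q (F - {z})
        = (Const (c z) * ?Q (F - {z})) * (1 - u z * (x - Const z)) + Const (c z) * u z * ?Q F"
        by (simp only:) (simp add: algebra_simps)
    qed
    also have "\<dots> = (\<Sum>z\<in>F. (Const (c z) * ?Q (F - {z})) * (1 - u z * (x - Const z)))"
      unfolding sum.distrib sum_distrib_right[symmetric] F(2) by simp
    also have "\<dots> \<in> ideal.span B"
      by (intro ideal.span_sum ideal.span_scale u)
    finally show ?thesis .
  qed
  ultimately show False
    using unit_in_ideal_of_roots[OF u] proper unfolding h_def by blast
qed

lemma exists_proper_specializations:
  assumes "1 \<notin> ideal.span B"
  shows "\<exists>a. 1 \<notin> ideal.span (B \<union> (\<lambda>i. X i - Const (a i)) ` {..<n})"
proof (induction n)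
  case 0
  show ?case using assms by simp
next
  case (Suc n)
  then obtain a where "1 \<notin> ideal.span (B \<union> (\<lambda>i. X i - Const (a i)) ` {..<n})" by blast
  from exists_proper_specialization[OF this, of "X n"]
  obtain z where z: "1 \<notin> ideal.span (insert (X n - Const z) (B \<union> (\<lambda>i. X i - Const (a i)) ` {..<n}))"
    by blast
  have eq: "(\<lambda>i. X i - Const ((a(n := z)) i)) ` {..<Suc n}
      = insert (X n - Const z) ((\<lambda>i. X i - Const (a i)) ` {..<n})"
    unfolding lessThan_Suc by auto
  then have "1 \<notin> ideal.span (B \<union> (\<lambda>i. X i - Const ((a(n := z)) i)) ` {..<Suc n})"
    using z by (simp only: eq Un_insert_right not_False_eq_True)
  then show ?case by blast
qed

lemma minus_peval_in_ideal:
  assumes "f \<in> polys V" "\<And>i. i \<in> V \<Longrightarrow> X i - Const (a i) \<in> ideal.span B"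
  shows "f - Const (peval f a) \<in> ideal.span B"
  using assms(1)
proof (induction rule: polys_induct)
  case (add f g)
  from ideal.span_add[OF this] show ?case
    by (simp add: peval_simps Const_def single_add algebra_simps)
next
  case (mult f g)
  have "f * g - Const (peval (f * g) a)
    = g * (f - Const (peval f a)) + Const (peval f a) * (g - Const (peval g a))"
    by (simp add: peval_simps Const_def mult_single algebra_simps)
  then show ?case
    using mult by (metis ideal.span_add ideal.span_scale)
qed (use assms(2) in \<open>auto simp: peval_simps intro: ideal.span_zero\<close>)

text \<open>After all x_i - a_i are adjoined the ideal is still proper, but it contains the constant
  \<open>peval f a\<close> for each generator f, and a nonzero constant would be a unit.\<close>

theorem weak_nullstellensatz:
  assumes "B \<subseteq> polys {..n}" "1 \<notin> ideal.span B"
  obtains a where "\<And>f. f \<in> B \<Longrightarrow> peval f a = 0"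
proof -
  obtain a where a: "1 \<notin> ideal.span (B \<union> (\<lambda>i. X i - Const (a i)) ` {..<Suc n})" (is "_ \<notin> ideal.span ?D")
    using exists_proper_specializations[OF assms(2)] by blast
  have "peval f a = 0" if f: "f \<in> B" for f
  proof (rule ccontr)
    assume nz: "peval f a \<noteq> 0"
    have "f - Const (peval f a) \<in> ideal.span ?D"
      using f assms(1) by (intro minus_peval_in_ideal[of f "{..n}"] ideal.span_base) auto
    moreover have "f \<in> ideal.span ?D"
      using f by (intro ideal.span_base) simp
    ultimately have "f - (f - Const (peval f a)) \<in> ideal.span ?D"
      by (rule ideal.span_diff[rotated])
    then have "Const (peval f a) \<in> ideal.span ?D" by simp
    from ideal.span_scale[OF this, of "Const (inverse (peval f a))"] nz a show False
      by (simp add: Const_def mult_single)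
  qed
  then show ?thesis by (rule that)
qed

section \<open>Homogeneous components and homogeneous ideals\<close>

definition hom_part :: "nat \<Rightarrow> cpoly \<Rightarrow> cpoly"
  where "hom_part t f = (\<Sum>m\<in>{m \<in> ks f. mdeg m = t}. Poly_Mapping.single m (lk f m))"

lemma lookup_hom_part: "lk (hom_part t f) m = (if mdeg m = t then lk f m else 0)"
  by (auto simp: hom_part_def lookup_sum lookup_single when_def in_keys_iff)

lemma hom_part_add: "hom_part t (f + g) = hom_part t f + hom_part t g"
  by (rule poly_mapping_eqI) (simp add: lookup_hom_part lookup_add)

lemma hom_part_diff: "hom_part t (f - g) = hom_part t f - hom_part t g"
  by (rule poly_mapping_eqI) (simp add: lookup_hom_part lookup_minus)

lemma hom_part_mult_form:
  assumes g: "g \<in> forms V e"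
  shows "hom_part t (b * g) = (if e \<le> t then hom_part (t - e) b * g else 0)"
proof (rule poly_mapping_eqI)
  fix m
  have *: "lk b p * lk g q = 0" if "p + q = m" "mdeg m < e" for p q
    using g mdeg_add[of p q] that by (cases "lk g q = 0") (auto simp: forms_iff)
  have **: "(if mdeg m = t then lk b p * lk g q else 0) = lk (hom_part (t - e) b) p * lk g q"
    if "p + q = m" "e \<le> t" for p q
    using g mdeg_add[of p q] that by (cases "lk g q = 0") (auto simp: lookup_hom_part forms_iff)
  show "lk (hom_part t (b * g)) m = lk (if e \<le> t then hom_part (t - e) b * g else 0) m"
  proof (cases "e \<le> t")
    case True
    have "(\<Sum>(p, q)\<in>{(p, q). p + q = m}. if mdeg m = t then lk b p * lk g q else 0)
      = (\<Sum>(p, q)\<in>{(p, q). p + q = m}. lk (hom_part (t - e) b) p * lk g q)"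
      using ** True by (intro sum.cong) auto
    then show ?thesis
      using True by (auto simp: lookup_hom_part lookup_times)
  next
    case False
    then have "mdeg m = t \<Longrightarrow> (\<Sum>(p, q)\<in>{(p, q). p + q = m}. lk b p * lk g q) = 0"
      using * by (intro sum.neutral) auto
    with False show ?thesis by (simp add: lookup_hom_part lookup_times)
  qed
qed

lemma hom_part_in_ideal:
  assumes B: "\<And>g. g \<in> B \<Longrightarrow> \<exists>e. g \<in> forms V e" and "f \<in> ideal.span B"
  shows "hom_part t f \<in> ideal.span B"
  using assms(2)
proof (induction rule: ideal.span_induct_alt)
  case base
  show ?case by (simp add: hom_part_def ideal.span_zero)
next
  case (step c g f)
  then obtain e where "g \<in> forms V e" using B by blast
  then have "hom_part t (c * g) \<in> ideal.span B"
    using step.hyps(1) by (auto simp: hom_part_mult_form intro: ideal.span_zero ideal.span_scale ideal.span_base)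
  with step.IH show ?case unfolding hom_part_add by (intro ideal.span_add)
qed

text \<open>
  If $1 \equiv b (x_i - 1)$ modulo a homogeneous ideal, comparing components shows that $b_t \equiv -x_i^t$,
  and $b_t = 0$ for large $t$.
\<close>

lemma X_power_in_ideal:
  assumes B: "\<And>g. g \<in> B \<Longrightarrow> \<exists>e. g \<in> forms V e"
    and unit: "1 \<in> ideal.span (insert (X i - 1) B)"
  shows "\<exists>N. X i ^ N \<in> ideal.span B"
proof -
  obtain b where b: "1 - b * (X i - 1) \<in> ideal.span B"
    using unit by (auto simp: ideal.span_insert)
  have X: "X i \<in> forms UNIV 1" by (rule X_forms) simp
  have eq: "1 - b * (X i - 1) = 1 + b - b * X i" by (simp add: algebra_simps)
  have one: "hom_part t 1 = (if t = 0 then 1 else 0)" for t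
    by (rule poly_mapping_eqI) (auto simp: lookup_hom_part lookup_one when_def mdeg_def)
  have h: "hom_part t 1 + hom_part t b - hom_part t (b * X i) \<in> ideal.span B" for t
    using hom_part_in_ideal[OF B b, of t] unfolding eq hom_part_add hom_part_diff by blast
  have ind: "X i ^ t + hom_part t b \<in> ideal.span B" for t
  proof (induction t)
    case 0
    show ?case using h[of 0] by (simp add: one hom_part_mult_form[OF X])
  next
    case (Suc t)
    have "X i ^ Suc t + hom_part (Suc t) b = X i * (X i ^ t + hom_part t b)
      + (hom_part (Suc t) 1 + hom_part (Suc t) b - hom_part (Suc t) (b * X i))"
      by (simp add: one hom_part_mult_form[OF X] algebra_simps)
    then show ?case using Suc h by (metis ideal.span_add ideal.span_scale)
  qed
  define N where "N = Suc (\<Sum>m\<in>ks b. mdeg m)"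
  have "mdeg m < N" if "m \<in> ks b" for m
    using member_le_sum[of m "ks b" mdeg] that by (simp add: N_def)
  then have "hom_part N b = 0"
    by (intro poly_mapping_eqI) (auto simp: lookup_hom_part in_keys_iff)
  then show ?thesis using ind[of N] by auto
qed

section \<open>Monomial ideals and regularity of powers of the variables\<close>

lemma monomial_ideal_iff:
  "f \<in> ideal.span ((\<lambda>i. X i ^ N) ` I) \<longleftrightarrow> (\<forall>m\<in>ks f. \<exists>i\<in>I. N \<le> lk m i)"
proof
  assume "f \<in> ideal.span ((\<lambda>i. X i ^ N) ` I)"
  then show "\<forall>m\<in>ks f. \<exists>i\<in>I. N \<le> lk m i"
  proof (induction rule: ideal.span_induct_alt)
    case base
    show ?case by simp
  next
    case (step c x y)
    then obtain i where i: "i \<in> I" "x = Poly_Mapping.single (Poly_Mapping.single i N) 1"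
      by (auto simp: X_power)
    have "N \<le> lk m i" if "m \<in> ks (c * x)" for m
      using that keys_mult[of c x] unfolding i(2) by (auto simp: lookup_add split: if_splits)
    then show ?case
      using keys_add[of "c * x" y] step.IH i(1) by blast
  qed
next
  assume R: "\<forall>m\<in>ks f. \<exists>i\<in>I. N \<le> lk m i"
  have "Poly_Mapping.single m (lk f m) \<in> ideal.span ((\<lambda>i. X i ^ N) ` I)" if m: "m \<in> ks f" for m
  proof -
    obtain i where i: "i \<in> I" "N \<le> lk m i" using R m by blast
    have "m - Poly_Mapping.single i N + Poly_Mapping.single i N = m"
      using i(2) by (intro poly_mapping_eqI) (auto simp: lookup_add lookup_minus lookup_single when_def)
    then have "Poly_Mapping.single m (lk f m)
      = Poly_Mapping.single (m - Poly_Mapping.single i N) (lk f m) * X i ^ N"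
      by (simp add: X_power mult_single)
    then show ?thesis
      using i(1) by (simp only:) (intro ideal.span_scale ideal.span_base imageI)
  qed
  then have "(\<Sum>m\<in>ks f. Poly_Mapping.single m (lk f m)) \<in> ideal.span ((\<lambda>i. X i ^ N) ` I)"
    by (rule ideal.span_sum)
  then show "f \<in> ideal.span ((\<lambda>i. X i ^ N) ` I)" by (simp only: sum_singles)
qed

lemma lookup_single_times: "lk (Poly_Mapping.single p c * f) (p + m) = c * lk f (m :: mono)" for f :: cpoly
proof -
  have "lk (Poly_Mapping.single p c * f) (p + m)
    = (\<Sum>(a, b)\<in>{(p, m)}. lk (Poly_Mapping.single p c) a * lk f b)"
    unfolding lookup_times
    by (rule sum.mono_neutral_right[OF finite_splits]) (auto simp: lookup_single when_def split: if_splits)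
  then show ?thesis by simp
qed

text \<open>Membership in a monomial ideal is decided on each exponent vector, and multiplying by
  x_j^N changes only the exponent at j, which is not among those tested.\<close>

lemma X_power_regular:
  assumes "j \<notin> I" "X j ^ N * f \<in> ideal.span ((\<lambda>i. X i ^ N) ` I)"
  shows "f \<in> ideal.span ((\<lambda>i. X i ^ N) ` I)"
  unfolding monomial_ideal_iff
proof
  fix m assume "m \<in> ks f"
  then have "Poly_Mapping.single j N + m \<in> ks (X j ^ N * f)"
    unfolding X_power in_keys_iff lookup_single_times by simp
  then obtain i where "i \<in> I" "N \<le> lk (Poly_Mapping.single j N + m) i"
    using assms(2) unfolding monomial_ideal_iff by blast
  then show "\<exists>i\<in>I. N \<le> lk m i"
    using assms(1) by (auto simp: lookup_add lookup_single when_def split: if_splits)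
qed

lemma mdeg_ge_of_in_ideal:
  assumes "f \<in> ideal.span B" "\<And>g. g \<in> B \<Longrightarrow> g \<in> forms V e" "m \<in> ks f"
  shows "e \<le> mdeg m"
  using assms(1,3)
proof (induction arbitrary: m rule: ideal.span_induct_alt)
  case (step c x y)
  have "e \<le> mdeg k" if k: "k \<in> ks (c * x)" for k
  proof -
    obtain p q where "k = p + q" "q \<in> ks x" using k keys_mult[of c x] by auto
    then show ?thesis
      using assms(2)[OF step.hyps(1)] mdeg_add[of p q] by (simp add: forms_def)
  qed
  then show ?case using keys_add[of "c * x" y] step by blast
qed simp

text \<open>Every x_i is nilpotent modulo the ideal of the g_k: a common zero of the g_k and x_i - 1
  would be a point of projective space. So the ideal contains the regular sequence of the x_i^N, and
  therefore the coefficients q_k, but its nonzero elements have no monomials of degree below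
  e.\<close>

theorem no_low_degree_syzygies:
  assumes g: "\<And>k. k \<le> n \<Longrightarrow> g k \<in> forms {..n} e"
    and zero: "\<not> (\<exists>a. (\<exists>i\<le>n. a i \<noteq> 0) \<and> (\<forall>k\<le>n. peval (g k) a = 0))"
    and q: "\<And>k. k \<le> n \<Longrightarrow> q k \<in> forms V t" and "t < e"
    and syz: "(\<Sum>k\<le>n. q k * g k) = 0" and "k \<le> n"
  shows "q k = 0"
proof -
  let ?B = "g ` {..n}"
  have "\<exists>N. X i ^ N \<in> ideal.span ?B" if "i \<le> n" for i
  proof (rule X_power_in_ideal)
    show "\<exists>e. h \<in> forms {..n} e" if "h \<in> ?B" for h using g that by auto
    show "1 \<in> ideal.span (insert (X i - 1) ?B)"
    proof (rule ccontr)
      assume proper: "1 \<notin> ideal.span (insert (X i - 1) ?B)"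
      have eq: "X i - 1 = X i + Const (- 1)" by (simp add: Const_1 Const_uminus)
      have "X i - 1 \<in> polys {..n}"
        using X_forms[of i "{..n}"] \<open>i \<le> n\<close>
        by (auto simp: forms_def polys_def in_keys_iff lookup_minus lookup_one when_def split: if_splits)
      then have "insert (X i - 1) ?B \<subseteq> polys {..n}" using g by (auto simp: forms_def)
      then obtain a where a: "\<And>f. f \<in> insert (X i - 1) ?B \<Longrightarrow> peval f a = 0"
        using weak_nullstellensatz[OF _ proper] by blast
      from a[of "X i - 1"] have "a i = 1" unfolding eq by (simp add: peval_simps)
      then have "a i \<noteq> 0" by simp
      moreover have "\<forall>k\<le>n. peval (g k) a = 0" using a by blast
      ultimately show False using zero \<open>i \<le> n\<close> by blast
    qed
  qed
  then obtain M where M: "\<And>i. i \<le> n \<Longrightarrow> X i ^ M i \<in> ideal.span ?B" by metis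
  \<comment> \<open>One exponent for all variables, as the regularity of the powers is proved for a
    uniform exponent.\<close>
  define N where "N = (\<Sum>i\<le>n. M i)"
  have N: "X i ^ N \<in> ideal.span ?B" if "i \<le> n" for i
  proof -
    have "M i \<le> N" unfolding N_def using that by (intro member_le_sum) auto
    then have "X i ^ N = X i ^ (N - M i) * X i ^ M i" by (simp flip: power_add)
    then show ?thesis using M[OF that] ideal.span_scale by metis
  qed
  have "q k \<in> ideal.span (g ` {..<Suc n})"
  proof (rule syzygy_in_ideal)
    show "X j ^ N \<in> ideal.span (g ` {..<Suc n})" if "j < Suc n" for j
      using N that by (simp add: lessThan_Suc_atMost)
    show "h \<in> ideal.span ((\<lambda>i. X i ^ N) ` {..<j})" if "X j ^ N * h \<in> ideal.span ((\<lambda>i. X i ^ N) ` {..<j})" for j h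
      using that by (rule X_power_regular[rotated]) simp
  qed (use syz \<open>k \<le> n\<close> in \<open>simp_all add: lessThan_Suc_atMost\<close>)
  then have "e \<le> mdeg m" if "m \<in> ks (q k)" for m
    using mdeg_ge_of_in_ideal[OF _ _ that] g by (auto simp: lessThan_Suc_atMost)
  moreover have "mdeg m = t" if "m \<in> ks (q k)" for m
    using q[OF \<open>k \<le> n\<close>] that by (simp add: forms_def)
  ultimately have "ks (q k) = {}" using \<open>t < e\<close> by fastforce
  then show ?thesis by simp
qed

section \<open>Separation of variables\<close>

lemma lookup_X_times:
  "lk (X i * f) (Poly_Mapping.single i 1 + m) = lk f m"
  "lk m i = 0 \<Longrightarrow> lk (X i * f) m = 0"
proof -
  show "lk (X i * f) (Poly_Mapping.single i 1 + m) = lk f m"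
    unfolding X_def by (subst lookup_single_times) simp
  show "lk (X i * f) m = 0" if "lk m i = 0"
  proof (rule ccontr)
    assume "lk (X i * f) m \<noteq> 0"
    then have "m \<in> ks (X i * f)" by (simp add: in_keys_iff)
    then obtain a b where "m = a + b" "a \<in> ks (X i)" using keys_mult[of "X i" f] by blast
    then have "lk m i \<noteq> 0" by (simp add: X_def lookup_add)
    with that show False by contradiction
  qed
qed

lemma X_times_cancel: "X i * f = X i * g \<Longrightarrow> f = g"
  by (rule poly_mapping_eqI) (metis lookup_X_times(1))

lemma lookup_lin_form:
  "lk (lin_form A i) (Poly_Mapping.single s 1) = (if s < dim_col A then A $$ (i, s) else 0)"
proof -
  have eq: "(Poly_Mapping.single j (Suc 0) = Poly_Mapping.single s (Suc 0)) = (j = s)" for j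
    by (metis keys_single nat.distinct(1) singleton_inject)
  have "lk (lin_form A i) (Poly_Mapping.single s 1) = (\<Sum>j<dim_col A. if j = s then A $$ (i, j) else 0)"
    unfolding lin_form_def lookup_sum Const_def X_def mult_single
    by (intro sum.cong refl) (simp add: lookup_single when_def eq)
  then show ?thesis by simp
qed

lemma pdiff_Const_times: "pdiff i (Const c * f) = Const c * pdiff i f"
  by (simp add: pdiff_mult)

lemma pdiff_lin_form:
  assumes "j < dim_col A"
  shows "pdiff j (lin_form A i) = Const (A $$ (i, j))"
proof -
  have "pdiff j (lin_form A i) = (\<Sum>k<dim_col A. if k = j then Const (A $$ (i, k)) else 0)"
    unfolding lin_form_def pdiff_sum pdiff_Const_times pdiff_X by (intro sum.cong) auto
  then show ?thesis using assms by simp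
qed

text \<open>
  If $x_i f_j = \sum_k L_{ik} g_k$ with linear forms $L_{ik}$, then
  $\sum_k (x_1 L_{0k} - x_0 L_{1k}) g_k = 0$ is a quadratic syzygy, hence trivial, and $x_0$ divides $L_{0k}$.
\<close>

lemma partials_linear_combination_of_orbit_tangent_eq:
  assumes n: "n \<ge> 1" and d: "d > 3"
    and f: "f \<in> forms {..n} d" and g: "g \<in> forms {..n} d"
    and T: "orbit_tangent n f = orbit_tangent n g"
    and smooth: "smooth_hypersurface n g" and j: "j \<le> n"
  shows "\<exists>c. pdiff j f = (\<Sum>k\<le>n. Const (c k) * pdiff k g)"
proof -
  have fp: "f \<in> polys {..n}" and gp: "g \<in> polys {..n}" using f g by (auto simp: forms_def)
  have "\<exists>A\<in>carrier_mat (Suc n) (Suc n). X i * pdiff j f = (\<Sum>k\<le>n. lin_form A k * pdiff k g)" if "i \<le> n" for i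
  proof -
    have "X i * pdiff j f \<in> orbit_tangent n f"
      unfolding orbit_tangent_eq_span[OF fp] using that j by (intro cpoly.span_base) blast
    then show ?thesis unfolding T orbit_tangent_eq[OF gp] by blast
  qed
  from this[of 0] this[of 1] n obtain A B
    where A: "A \<in> carrier_mat (Suc n) (Suc n)" "X 0 * pdiff j f = (\<Sum>k\<le>n. lin_form A k * pdiff k g)"
      and B: "B \<in> carrier_mat (Suc n) (Suc n)" "X 1 * pdiff j f = (\<Sum>k\<le>n. lin_form B k * pdiff k g)"
    by auto
  define q where "q k = X 1 * lin_form A k - X 0 * lin_form B k" for k
  have q: "q k \<in> forms {..n} 2" for k
    unfolding q_def using times_forms[OF X_forms lin_form_forms[OF A(1)], of 1 k]
      times_forms[OF X_forms lin_form_forms[OF B(1)], of 0 k] n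
    by (intro cpoly.subspace_diff subspace_forms) (simp_all add: numeral_2_eq_2)
  have "(\<Sum>k\<le>n. q k * pdiff k g) = X 1 * (X 0 * pdiff j f) - X 0 * (X 1 * pdiff j f)"
    unfolding A(2) B(2) q_def by (simp add: left_diff_distrib sum_subtractf sum_distrib_left mult.assoc)
  then have syz: "(\<Sum>k\<le>n. q k * pdiff k g) = 0" by (simp add: mult.left_commute)
  have q0: "q k = 0" if "k \<le> n" for k
    using no_low_degree_syzygies[OF pdiff_forms[OF g] _ q _ syz that] smooth d
    unfolding smooth_hypersurface_def by simp
  have L: "lin_form A k = Const (A $$ (k, 0)) * X 0" if k: "k \<le> n" for k
  proof -
    \<comment> \<open>Compare the coefficients of x_1 x_s in the identity given by
      \<open>q k = 0\<close>: since s is not 0, the side divisible by x_0 contributes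
      nothing.\<close>
    have "A $$ (k, s) = 0" if s: "s \<noteq> 0" "s < Suc n" for s
    proof -
      have "X 1 * lin_form A k = X 0 * lin_form B k" using q0[OF k] by (simp add: q_def)
      moreover have "lk (X 1 * lin_form A k) (Poly_Mapping.single 1 1 + Poly_Mapping.single s 1) = A $$ (k, s)"
        unfolding lookup_X_times(1) lookup_lin_form using A(1) s(2) by simp
      moreover have "lk (X 0 * lin_form B k) (Poly_Mapping.single 1 1 + Poly_Mapping.single s 1) = 0"
        using s(1) by (intro lookup_X_times(2)) (simp add: lookup_add lookup_single)
      ultimately show ?thesis by simp
    qed
    then have "lin_form A k = (\<Sum>s<Suc n. if s = 0 then Const (A $$ (k, s)) * X s else 0)"
      unfolding lin_form_def using A(1) by (intro sum.cong) (auto simp: Const_0)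
    then show ?thesis by (simp del: sum.lessThan_Suc)
  qed
  have "X 0 * pdiff j f = X 0 * (\<Sum>k\<le>n. Const (A $$ (k, 0)) * pdiff k g)"
    unfolding A(2) sum_distrib_left using L by (intro sum.cong) (simp_all add: mult_ac)
  then show ?thesis by (intro exI) (rule X_times_cancel)
qed

section \<open>Jordan form and linear changes of coordinates\<close>

lemma jordan_matrix_entries:
  fixes n_as :: "(nat \<times> complex) list"
  assumes "i < sum_list (map fst n_as)" "j < sum_list (map fst n_as)" "i \<noteq> j"
    "jordan_matrix n_as $$ (i, j) \<noteq> 0"
  shows "j = Suc i \<and> jordan_matrix n_as $$ (i, j) = 1 \<and> jordan_matrix n_as $$ (j, j) = jordan_matrix n_as $$ (i, i)"
  using assms
proof (induction n_as arbitrary: i j)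
  case Nil
  then show ?case by simp
next
  case (Cons na n_as)
  obtain k a where na: "na = (k, a)" by (cases na)
  let ?J = "jordan_matrix n_as"
  have entry: "jordan_matrix (na # n_as) $$ (i, j) =
    (if i < k then if j < k then jordan_block k a $$ (i, j) else 0
     else if j < k then 0 else ?J $$ (i - k, j - k))"
    if "i < k + sum_list (map fst n_as)" "j < k + sum_list (map fst n_as)" for i j
    using that unfolding na jordan_matrix_Cons by (simp add: index_mat_four_block)
  have ij: "i < k + sum_list (map fst n_as)" "j < k + sum_list (map fst n_as)" using Cons.prems na by auto
  have nz: "jordan_matrix (na # n_as) $$ (i, j) \<noteq> 0" by (rule Cons.prems(4))
  \<comment> \<open>A nonzero entry lies in a diagonal block: either in the first one, or in those
    of the tail with both indices shifted by k.\<close>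
  consider (1) "i < k" "j < k" | (2) "\<not> i < k" "\<not> j < k"
    using nz unfolding entry[OF ij] by (auto split: if_splits)
  then show ?case
  proof cases
    case 1
    then show ?thesis
      using nz Cons.prems(3) unfolding entry[OF ij] entry[OF ij(1) ij(1)] entry[OF ij(2) ij(2)]
      by (auto split: if_splits)
  next
    case 2
    then have "i - k < sum_list (map fst n_as)" "j - k < sum_list (map fst n_as)" "i - k \<noteq> j - k"
      "?J $$ (i - k, j - k) \<noteq> 0"
      using ij nz Cons.prems(3) unfolding entry[OF ij] by auto
    from Cons.IH[OF this] 2 show ?thesis
      unfolding entry[OF ij] entry[OF ij(1) ij(1)] entry[OF ij(2) ij(2)] by auto
  qed
qed

text \<open>Only the shape of the entries is kept. Equality of the two diagonal entries records that
  a superdiagonal 1 stays inside one block and so ties together indices with the same eigenvalue.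
  The form exists because complex characteristic polynomials split.\<close>

lemma exists_jordan_basis:
  fixes T :: "complex mat"
  assumes T: "T \<in> carrier_mat n n"
  obtains P Q J where "P \<in> carrier_mat n n" "Q \<in> carrier_mat n n" "J \<in> carrier_mat n n"
    "P * Q = 1\<^sub>m n" "Q * P = 1\<^sub>m n" "T * P = P * J"
    "\<And>i j. i < n \<Longrightarrow> j < n \<Longrightarrow> i \<noteq> j \<Longrightarrow> J $$ (i, j) \<noteq> 0 \<Longrightarrow>
      j = Suc i \<and> J $$ (i, j) = 1 \<and> J $$ (j, j) = J $$ (i, i)"
proof -
  obtain n_as where "jordan_nf T n_as"
    using char_poly_factorized[OF T] jordan_nf_exists[OF T] by blast
  then obtain P Q where w: "similar_mat_wit T (jordan_matrix n_as) P Q"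
    unfolding jordan_nf_def similar_mat_def by blast
  let ?J = "jordan_matrix n_as"
  from similar_mat_witD2[OF T w] have
    c: "?J \<in> carrier_mat n n" "P \<in> carrier_mat n n" "Q \<in> carrier_mat n n"
      "P * Q = 1\<^sub>m n" "Q * P = 1\<^sub>m n" "T = P * ?J * Q" by auto
  have "T * P = P * ?J * (Q * P)"
    unfolding c(6) using c(1-3) by (intro assoc_mult_mat[of _ n n _ n _ n]) auto
  also have "\<dots> = P * ?J"
    unfolding c(5) using mult_carrier_mat[OF c(2,1)] by (rule right_mult_one_mat)
  finally have TP: "T * P = P * ?J" .
  have "sum_list (map fst n_as) = n" using c(1) by auto
  then show ?thesis
    using jordan_matrix_entries[of _ n_as] by (intro that[OF c(2,3,1,4,5) TP]) blast
qed

lemma mat_mult_entry: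
  assumes "A \<in> carrier_mat (Suc n) (Suc n)" "B \<in> carrier_mat (Suc n) (Suc n)" "i \<le> n" "j \<le> n"
  shows "(A * B) $$ (i, j) = (\<Sum>k\<le>n. A $$ (i, k) * B $$ (k, j))"
  using assms by (simp add: scalar_prod_def lessThan_Suc_atMost atLeast0LessThan)

text \<open>Substituting \<open>Q\<close> into f(Px) gives f(PQx), which explains the order of the
  factors in the hypothesis.\<close>

lemma lin_subst_lin_subst_inverse:
  assumes P: "P \<in> carrier_mat (Suc n) (Suc n)" and Q: "Q \<in> carrier_mat (Suc n) (Suc n)"
    and PQ: "P * Q = 1\<^sub>m (Suc n)" and f: "f \<in> polys {..n}"
  shows "lin_subst Q (lin_subst P f) = f"
proof -
  have "psubst (lin_form Q) (lin_form P i) = X i" if i: "i \<le> n" for i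
  proof -
    have "psubst (lin_form Q) (lin_form P i)
      = (\<Sum>j\<le>n. \<Sum>k\<le>n. Const (P $$ (i, j) * Q $$ (j, k)) * X k)"
      using P Q unfolding lin_form_def
      by (simp add: psubst_sum psubst_simps sum_distrib_left Const_mult mult.assoc lessThan_Suc_atMost
          del: sum.lessThan_Suc sum.atMost_Suc)
    also have "\<dots> = (\<Sum>k\<le>n. (\<Sum>j\<le>n. Const (P $$ (i, j) * Q $$ (j, k))) * X k)"
      unfolding sum_distrib_right by (rule sum.swap)
    also have "\<dots> = (\<Sum>k\<le>n. if k = i then X k else 0)"
    proof (rule sum.cong[OF refl])
      fix k assume "k \<in> {..n}"
      then have "(\<Sum>j\<le>n. P $$ (i, j) * Q $$ (j, k)) = (if k = i then 1 else 0)"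
        using mat_mult_entry[OF P Q i, of k] i unfolding PQ by auto
      moreover have "(\<Sum>j\<le>n. Const (P $$ (i, j) * Q $$ (j, k))) = Const (\<Sum>j\<le>n. P $$ (i, j) * Q $$ (j, k))"
        by (induction n) (simp_all add: Const_add)
      ultimately show "(\<Sum>j\<le>n. Const (P $$ (i, j) * Q $$ (j, k))) * X k = (if k = i then X k else 0)"
        by (simp add: Const_0 Const_1)
    qed
    also have "\<dots> = X i" using i by simp
    finally show ?thesis .
  qed
  then have "lin_subst Q (lin_subst P f) = psubst X f"
    unfolding lin_subst_def psubst_psubst by (intro psubst_cong[OF f]) auto
  then show ?thesis by simp
qed

text \<open>At the i-th coordinate point only x_i^(d-1) contributes to the partial h_j, and it comes
  from x_i^(d-1) x_j in h. As d - 1 is at least 2, that coefficient of h is visible in h_ii, hence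
  zero.\<close>

lemma singular_of_pure_second_partial_zero:
  assumes h: "h \<in> forms V d" and d: "d \<ge> 3" and zero: "pdiff i (pdiff i h) = 0"
  shows "peval (pdiff j h) (\<lambda>k. if k = i then 1 else 0) = 0"
  unfolding peval_def
proof (intro sum.neutral ballI)
  fix m assume m: "m \<in> ks (pdiff j h)"
  let ?e = "\<lambda>i. Poly_Mapping.single i (1 :: nat)"
  show "lk (pdiff j h) m * (\<Prod>k\<in>ks m. (if k = i then 1 else 0) ^ lk m k) = 0"
  proof (cases "ks m \<subseteq> {i}")
    case True
    have "mdeg m = d - 1"
      using m pdiff_forms[OF h, of j] by (simp add: forms_def)
    then have "2 \<le> lk m i"
      using d mdeg_superset[OF _ True] by simp
    then have "m = (m - Poly_Mapping.single i 2) + ?e i + ?e i"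
      by (intro poly_mapping_eqI) (auto simp: lookup_add lookup_minus lookup_single when_def)
    then obtain p where p: "m = p + ?e i + ?e i" by blast
    have "lk (pdiff i (pdiff i h)) (p + ?e j) = 0" by (simp add: zero)
    then have "lk h (p + ?e j + ?e i + ?e i) = 0"
      unfolding lookup_pdiff by (simp del: of_nat_add of_nat_Suc)
    then have "lk h (m + ?e j) = 0" unfolding p by (simp add: add_ac)
    then show ?thesis by (simp add: lookup_pdiff)
  next
    case False
    then obtain k where "k \<in> ks m" "k \<noteq> i" by blast
    then have "(\<Prod>k\<in>ks m. (if k = i then 1 else 0) ^ lk m k) = (0 :: complex)"
      by (intro prod_zero) (auto simp: in_keys_iff)
    then show ?thesis by simp
  qed
qed

text \<open>A monomial with variables on both sides of the partition would survive in a mixed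
  partial, since differentiation multiplies its coefficient by positive integers.\<close>

lemma split_of_mixed_partials_zero:
  assumes h: "h \<in> forms V d"
    and zero: "\<And>i j. i \<in> S \<Longrightarrow> j \<in> V - S \<Longrightarrow> pdiff i (pdiff j h) = 0"
  obtains p q where "p \<in> forms S d" "q \<in> forms (V - S) d" "h = p + q"
proof -
  define p where "p = (\<Sum>m\<in>{m \<in> ks h. ks m \<subseteq> S}. Poly_Mapping.single m (lk h m))"
  have p: "lk p m = (if ks m \<subseteq> S then lk h m else 0)" for m
    by (auto simp: p_def lookup_sum lookup_single when_def in_keys_iff)
  have "p \<in> forms S d" using h by (auto simp: forms_iff p)
  moreover have "h - p \<in> forms (V - S) d"
    unfolding forms_iff
  proof (intro allI impI)
    fix m assume m: "lk (h - p) m \<noteq> 0"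
    then have hm: "lk h m \<noteq> 0" "\<not> ks m \<subseteq> S" by (auto simp: lookup_minus p split: if_splits)
    then have V: "ks m \<subseteq> V" "mdeg m = d" using h by (auto simp: forms_iff)
    obtain j where j: "j \<in> ks m" "j \<in> V - S" using hm(2) V(1) by blast
    have "i \<notin> S" if i: "i \<in> ks m" for i
    proof
      assume "i \<in> S"
      then have "i \<noteq> j" using j by auto
      let ?e = "\<lambda>i. Poly_Mapping.single i (1 :: nat)"
      have "m = (m - ?e i - ?e j) + ?e i + ?e j"
        using i j(1) \<open>i \<noteq> j\<close>
        by (intro poly_mapping_eqI) (auto simp: lookup_add lookup_minus lookup_single when_def in_keys_iff)
      then obtain r where r: "m = r + ?e i + ?e j" by blast
      have "lk (pdiff i (pdiff j h)) r = 0" by (simp add: zero[OF \<open>i \<in> S\<close> j(2)])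
      then have "lk h m = 0"
        unfolding lookup_pdiff r by (simp del: of_nat_add of_nat_Suc)
      with hm show False by simp
    qed
    with V show "ks m \<subseteq> V - S \<and> mdeg m = d" by blast
  qed
  ultimately show ?thesis by (rule that) simp
qed

text \<open>\<open>sebastiani_thom\<close> asks for an initial and a final block of coordinates,
  whereas eigenvalue classes may be interleaved.\<close>

lemma exists_permutation_onto_initial_segment:
  fixes n :: nat
  assumes S: "S \<subseteq> {..n}" "S \<noteq> {}" "S \<noteq> {..n}"
  obtains l \<rho> where "l < n" "bij_betw \<rho> {..l} S" "bij_betw \<rho> {l<..n} ({..n} - S)"
proof -
  have fin: "finite S" using S(1) finite_subset by blast
  \<comment> \<open>The block \<open>{..l}\<close> has l + 1 elements; that S is proper then gives l
    < n.\<close>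
  define l where "l = card S - 1"
  have card: "card S = Suc l" using S(2) fin by (simp add: l_def card_gt_0_iff)
  have "card S < Suc n" using psubset_card_mono[of "{..n}" S] S by auto
  then have l: "l < n" using card by simp
  obtain \<phi> where \<phi>: "bij_betw \<phi> {..l} S"
    using finite_same_card_bij[of "{..l}" S] fin card by auto
  have "card ({..n} - S) = n - l" using card_Diff_subset[OF fin S(1)] card by simp
  then obtain \<psi> where \<psi>: "bij_betw \<psi> {l<..n} ({..n} - S)"
    using finite_same_card_bij[of "{l<..n}" "{..n} - S"] by auto
  let ?\<rho> = "\<lambda>x. if x \<le> l then \<phi> x else \<psi> x"
  have "bij_betw ?\<rho> {..l} S" using \<phi> by (rule bij_betw_cong[THEN iffD1, rotated]) simp
  moreover have "bij_betw ?\<rho> {l<..n} ({..n} - S)" using \<psi> by (rule bij_betw_cong[THEN iffD1, rotated]) simp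
  ultimately show ?thesis using l by (rule that[rotated])
qed

text \<open>The splitting holds in the coordinates given by the rows of \<open>Q\<close>. Permuting
  the rows brings the variables of \<open>S\<close> to the front, and permuting the columns of
  \<open>P\<close> alike supplies the inverse matrix.\<close>

lemma sebastiani_thom_of_split:
  assumes P: "P \<in> carrier_mat (Suc n) (Suc n)" and Q: "Q \<in> carrier_mat (Suc n) (Suc n)"
    and PQ: "P * Q = 1\<^sub>m (Suc n)" and QP: "Q * P = 1\<^sub>m (Suc n)"
    and S: "S \<subseteq> {..n}" "S \<noteq> {}" "S \<noteq> {..n}"
    and p: "p \<in> forms S d" and q: "q \<in> forms ({..n} - S) d"
  shows "sebastiani_thom n d (lin_subst Q (p + q))"
proof -
  obtain l \<rho> where l: "l < n" and \<rho>: "bij_betw \<rho> {..l} S" "bij_betw \<rho> {l<..n} ({..n} - S)"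
    using exists_permutation_onto_initial_segment[OF S] by blast
  have "bij_betw \<rho> ({..l} \<union> {l<..n}) (S \<union> ({..n} - S))"
    by (rule bij_betw_combine[OF \<rho>]) auto
  moreover have "{..l} \<union> {l<..n} = {..n}" "S \<union> ({..n} - S) = {..n}" using l S(1) by auto
  ultimately have bij: "bij_betw \<rho> {..n} {..n}" by simp
  define \<tau> where "\<tau> = inv_into {..n} \<rho>"
  have \<rho>\<tau>: "\<rho> (\<tau> i) = i" "\<tau> i \<le> n" if "i \<le> n" for i
    using bij_betw_inv_into_right[OF bij] bij_betw_imp_surj_on[OF bij] inv_into_into[of i \<rho> "{..n}"] that
    by (auto simp: \<tau>_def)
  have \<tau>\<rho>: "\<tau> (\<rho> i) = i" "\<rho> i \<le> n" if "i \<le> n" for i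
    using bij_betw_inv_into_left[OF bij] bij_betwE[OF bij] that by (auto simp: \<tau>_def)
  have \<tau>S: "\<tau> i \<in> {..l}" if "i \<in> S" for i
  proof -
    have "i \<in> \<rho> ` {..l}" unfolding bij_betw_imp_surj_on[OF \<rho>(1)] by (rule that)
    then obtain x where x: "x \<le> l" "i = \<rho> x" by auto
    have "\<tau> i = x" unfolding x(2) using x(1) l by (intro \<tau>\<rho>(1)) linarith
    then show ?thesis using x(1) by simp
  qed
  have \<tau>S': "\<tau> i \<in> {l<..n}" if "i \<in> {..n} - S" for i
  proof -
    have "i \<in> \<rho> ` {l<..n}" unfolding bij_betw_imp_surj_on[OF \<rho>(2)] by (rule that)
    then obtain x where x: "x \<in> {l<..n}" "i = \<rho> x" by auto
    have "\<tau> i = x" unfolding x(2) using x(1) by (intro \<tau>\<rho>(1)) simp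
    then show ?thesis using x(1) by simp
  qed
  define A where "A = mat (Suc n) (Suc n) (\<lambda>(i, k). Q $$ (\<rho> i, k))"
  define B where "B = mat (Suc n) (Suc n) (\<lambda>(k, i). P $$ (k, \<rho> i))"
  have AB: "A \<in> carrier_mat (Suc n) (Suc n)" "B \<in> carrier_mat (Suc n) (Suc n)" by (simp_all add: A_def B_def)
  have "A * B = 1\<^sub>m (Suc n)"
  proof (rule eq_matI)
    fix i j assume "i < dim_row (1\<^sub>m (Suc n))" "j < dim_col (1\<^sub>m (Suc n))"
    then have ij: "i \<le> n" "j \<le> n" by auto
    have "(A * B) $$ (i, j) = (\<Sum>k\<le>n. Q $$ (\<rho> i, k) * P $$ (k, \<rho> j))"
      unfolding mat_mult_entry[OF AB ij] using ij by (intro sum.cong) (auto simp: A_def B_def)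
    also have "\<dots> = (Q * P) $$ (\<rho> i, \<rho> j)"
      using mat_mult_entry[OF Q P] \<tau>\<rho>(2) ij by simp
    also have "\<dots> = 1\<^sub>m (Suc n) $$ (i, j)"
    proof -
      have "\<rho> i = \<rho> j \<longleftrightarrow> i = j" using \<tau>\<rho>(1) ij by metis
      then show ?thesis
        unfolding QP using ij \<tau>\<rho>(2)[OF ij(1)] \<tau>\<rho>(2)[OF ij(2)] by (simp add: less_Suc_eq_le)
    qed
    finally show "(A * B) $$ (i, j) = 1\<^sub>m (Suc n) $$ (i, j)" .
  qed (simp_all add: A_def B_def)
  moreover from this have "B * A = 1\<^sub>m (Suc n)" by (rule mat_mult_left_right_inverse[OF AB])
  ultimately have "A \<in> GL n"
    using AB by (auto simp: GL_def invertible_mat_def inverts_mat_def)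
  moreover have "psubst (\<lambda>i. X (\<tau> i)) p \<in> forms {..l} d" "psubst (\<lambda>i. X (\<tau> i)) q \<in> forms {l<..n} d"
    using psubst_forms[OF p X_forms[OF \<tau>S]] psubst_forms[OF q X_forms[OF \<tau>S']] by auto
  moreover have "lin_subst Q (p + q) = lin_subst A (psubst (\<lambda>i. X (\<tau> i)) p + psubst (\<lambda>i. X (\<tau> i)) q)"
  proof -
    have "p \<in> polys {..n}" "q \<in> polys {..n}"
      using p q S(1) unfolding forms_def polys_def by blast+
    moreover have "lin_form Q i = lin_form A (\<tau> i)" if "i \<le> n" for i
      unfolding lin_form_def using Q AB(1) \<rho>\<tau>[OF that] by (intro sum.cong) (auto simp: A_def)
    ultimately have "psubst (lin_form Q) p = psubst (\<lambda>i. lin_form A (\<tau> i)) p"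
      "psubst (lin_form Q) q = psubst (\<lambda>i. lin_form A (\<tau> i)) q"
      by (auto intro!: psubst_cong)
    then show ?thesis
      by (simp add: lin_subst_def psubst_simps psubst_psubst)
  qed
  ultimately show ?thesis
    unfolding sebastiani_thom_def using l by blast
qed

text \<open>A form of positive degree is determined by its partials: each of its monomials contains
  some x_j, and in characteristic zero the derivative along x_j returns the coefficient.\<close>

lemma eq_Const_times_of_partials:
  assumes f: "f \<in> forms {..n} d" and g: "g \<in> forms {..n} d" and d: "d \<ge> 1"
    and part: "\<And>j. j \<le> n \<Longrightarrow> pdiff j f = Const c * pdiff j g"
  shows "f = Const c * g"
proof (rule poly_mapping_eqI)
  fix m
  have C: "lk (Const c * h) k = c * lk h k" for h k
    using lookup_single_times[of 0 c h k] by (simp add: Const_def)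
  show "lk f m = lk (Const c * g) m"
  proof (cases "ks m \<subseteq> {..n} \<and> mdeg m = d")
    case True
    then obtain j where j: "j \<in> ks m" using d by (fastforce simp: mdeg_def)
    let ?e = "Poly_Mapping.single j (1 :: nat)"
    have m: "m - ?e + ?e = m"
      using j by (intro poly_mapping_eqI) (auto simp: lookup_add lookup_minus lookup_single when_def in_keys_iff)
    have "lk (pdiff j f) (m - ?e) = lk (Const c * pdiff j g) (m - ?e)"
      using part[of j] j True by auto
    then have "of_nat (lk (m - ?e) j + 1) * lk f m = of_nat (lk (m - ?e) j + 1) * (c * lk g m)"
      unfolding C lookup_pdiff m by (simp only: mult.left_commute)
    then show ?thesis unfolding C by (simp del: of_nat_add of_nat_Suc)
  next
    case False
    then show ?thesis using f g unfolding C forms_iff by (metis mult_zero_right)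
  qed
qed

theorem corollary1p5:
  fixes n d :: nat and f g :: cpoly
  assumes "n \<ge> 1" and "d > 3"
    and "homogeneous n d f" and "homogeneous n d g"
    and "orbit_tangent n f = orbit_tangent n g"
    and "\<not> same_hypersurface f g"
    and "smooth_hypersurface n g"
  shows "sebastiani_thom n d g"
proof -
  have f: "f \<in> forms {..n} d" "f \<noteq> 0" and g: "g \<in> forms {..n} d"
    using assms(3,4) by (auto simp: homogeneous_def)
  have fp: "f \<in> polys {..n}" and gp: "g \<in> polys {..n}" using f g by (auto simp: forms_def)
  have "\<forall>j. \<exists>c. j \<le> n \<longrightarrow> pdiff j f = (\<Sum>k\<le>n. Const (c k) * pdiff k g)"
    using partials_linear_combination_of_orbit_tangent_eq[OF assms(1,2) f(1) g assms(5,7)] by blast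
  then obtain M where M: "\<And>j. j \<le> n \<Longrightarrow> pdiff j f = (\<Sum>k\<le>n. Const (M j k) * pdiff k g)"
    by metis
  \<comment> \<open>Transposed: column j holds the coefficients of f_j. The gradient of u(Px) picks
    up the transpose of P, so in the new coordinates the relation, again read by columns, is given
    by \<open>J\<close> with \<open>T * P = P * J\<close>.\<close>
  define T where "T = mat (Suc n) (Suc n) (\<lambda>(k, j). M j k)"
  have T: "T \<in> carrier_mat (Suc n) (Suc n)" by (simp add: T_def)
  obtain P Q J where P: "P \<in> carrier_mat (Suc n) (Suc n)" and Q: "Q \<in> carrier_mat (Suc n) (Suc n)"
    and J: "J \<in> carrier_mat (Suc n) (Suc n)"
    and PQ: "P * Q = 1\<^sub>m (Suc n)" and QP: "Q * P = 1\<^sub>m (Suc n)" and TP: "T * P = P * J"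
    and jordan: "\<And>i j. i < Suc n \<Longrightarrow> j < Suc n \<Longrightarrow> i \<noteq> j \<Longrightarrow> J $$ (i, j) \<noteq> 0 \<Longrightarrow>
      j = Suc i \<and> J $$ (i, j) = 1 \<and> J $$ (j, j) = J $$ (i, i)"
    using exists_jordan_basis[OF T] by blast
  define F where "F = lin_subst P f"
  define h where "h = lin_subst P g"
  \<comment> \<open>Partials of g taken in the old coordinates and then transported. The gradients
    of \<open>F\<close> and \<open>h\<close> both expand in these, so \<open>T * P = P * J\<close>
    relates them at once.\<close>
  define G where "G l = lin_subst P (pdiff l g)" for l
  have F: "F \<in> forms {..n} d" and h: "h \<in> forms {..n} d"
    unfolding F_def h_def lin_subst_def using psubst_forms[OF _ lin_form_forms[OF P]] f(1) g by auto
  have chain: "pdiff j (lin_subst P u) = (\<Sum>k\<le>n. Const (P $$ (k, j)) * lin_subst P (pdiff k u))"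
    if "u \<in> polys {..n}" "j \<le> n" for u j
    unfolding lin_subst_def using that P
    by (subst pdiff_psubst[OF that(1)]) (auto intro!: sum.cong simp: pdiff_lin_form)
  have ConstS: "Const (\<Sum>k\<le>n. c k) = (\<Sum>k\<le>n. Const (c k))" for c
    by (induction n) (simp_all add: Const_add)
  have hG: "pdiff j h = (\<Sum>l\<le>n. Const (P $$ (l, j)) * G l)" if "j \<le> n" for j
    unfolding h_def G_def by (rule chain[OF gp that])
  have FG: "pdiff j F = (\<Sum>l\<le>n. Const ((T * P) $$ (l, j)) * G l)" if j: "j \<le> n" for j
  proof -
    have "pdiff j F = (\<Sum>k\<le>n. \<Sum>l\<le>n. Const (T $$ (l, k) * P $$ (k, j)) * G l)"
      unfolding F_def chain[OF fp j]
    proof (rule sum.cong[OF refl])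
      fix k assume "k \<in> {..n}"
      then have "lin_subst P (pdiff k f) = (\<Sum>l\<le>n. Const (T $$ (l, k)) * G l)"
        by (auto simp: M G_def lin_subst_def psubst_sum psubst_simps T_def intro!: sum.cong)
      then show "Const (P $$ (k, j)) * lin_subst P (pdiff k f) = (\<Sum>l\<le>n. Const (T $$ (l, k) * P $$ (k, j)) * G l)"
        by (simp only: sum_distrib_left Const_mult mult_ac)
    qed
    also have "\<dots> = (\<Sum>l\<le>n. \<Sum>k\<le>n. Const (T $$ (l, k) * P $$ (k, j)) * G l)"
      by (rule sum.swap)
    also have "\<dots> = (\<Sum>l\<le>n. Const ((T * P) $$ (l, j)) * G l)"
      by (intro sum.cong refl) (simp add: mat_mult_entry[OF T P _ j] ConstS sum_distrib_right)
    finally show ?thesis .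
  qed
  have FJ: "pdiff j F = (\<Sum>i\<le>n. Const (J $$ (i, j)) * pdiff i h)" if j: "j \<le> n" for j
  proof -
    have "(\<Sum>i\<le>n. Const (J $$ (i, j)) * pdiff i h) = (\<Sum>i\<le>n. \<Sum>l\<le>n. Const (P $$ (l, i) * J $$ (i, j)) * G l)"
      by (intro sum.cong refl) (simp add: hG sum_distrib_left Const_mult mult_ac)
    also have "\<dots> = (\<Sum>l\<le>n. \<Sum>i\<le>n. Const (P $$ (l, i) * J $$ (i, j)) * G l)"
      by (rule sum.swap)
    also have "\<dots> = (\<Sum>l\<le>n. Const ((P * J) $$ (l, j)) * G l)"
      by (intro sum.cong refl) (simp add: mat_mult_entry[OF P J _ j] ConstS sum_distrib_right)
    finally show ?thesis unfolding FG[OF j] TP by simp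
  qed
  \<comment> \<open>The i-th coordinate point corresponds in the coordinates of g to the i-th column
    of P, which is nonzero. Inverting the chain rule with \<open>Q\<close> carries the vanishing of
    the partials of \<open>h\<close> over to those of g.\<close>
  have pure: "pdiff i (pdiff i h) \<noteq> 0" if i: "i \<le> n" for i
  proof
    assume "pdiff i (pdiff i h) = 0"
    then have sing: "peval (pdiff j h) (\<lambda>k. if k = i then 1 else 0) = 0" for j
      using h assms(2) by (intro singular_of_pure_second_partial_zero) auto
    define a where "a k = peval (lin_form P k) (\<lambda>k. if k = i then 1 else 0)" for k
    have a: "a k = P $$ (k, i)" for k
    proof -
      have "a k = (\<Sum>j<Suc n. P $$ (k, j) * (if j = i then 1 else 0))"
        unfolding a_def lin_form_def using P
        by (simp add: peval_sum peval_simps del: sum.lessThan_Suc)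
      also have "\<dots> = (\<Sum>j<Suc n. if j = i then P $$ (k, j) else 0)"
        by (intro sum.cong) auto
      finally show ?thesis using i by (simp del: sum.lessThan_Suc)
    qed
    have "\<exists>k\<le>n. a k \<noteq> 0"
    proof (rule ccontr)
      assume "\<not> ?thesis"
      then have "(Q * P) $$ (i, i) = 0"
        unfolding mat_mult_entry[OF Q P i i] by (simp add: a)
      then show False unfolding QP using i by simp
    qed
    moreover have "peval (pdiff l g) a = 0" if l: "l \<le> n" for l
    proof -
      have "(\<Sum>j\<le>n. Const (Q $$ (j, l)) * pdiff j h) = (\<Sum>j\<le>n. \<Sum>k\<le>n. Const (P $$ (k, j) * Q $$ (j, l)) * G k)"
        by (intro sum.cong refl) (simp add: hG sum_distrib_left Const_mult mult_ac)
      also have "\<dots> = (\<Sum>k\<le>n. \<Sum>j\<le>n. Const (P $$ (k, j) * Q $$ (j, l)) * G k)"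
        by (rule sum.swap)
      also have "\<dots> = (\<Sum>k\<le>n. Const ((P * Q) $$ (k, l)) * G k)"
        by (intro sum.cong refl) (simp add: mat_mult_entry[OF P Q _ l] ConstS sum_distrib_right)
      also have "\<dots> = (\<Sum>k\<le>n. if k = l then G k else 0)"
        unfolding PQ using l by (intro sum.cong refl) (auto simp: Const_0 Const_1)
      also have "\<dots> = G l" using l by simp
      finally have "G l = (\<Sum>j\<le>n. Const (Q $$ (j, l)) * pdiff j h)" by simp
      moreover have "peval (pdiff l g) a = peval (G l) (\<lambda>k. if k = i then 1 else 0)"
        unfolding G_def lin_subst_def peval_psubst a_def ..
      ultimately show ?thesis by (simp add: peval_sum peval_simps sing)
    qed
    ultimately show False using assms(7) unfolding smooth_hypersurface_def by blast
  qed
  have diag: "J $$ (i, j) = 0" if "i \<le> n" "j \<le> n" "i \<noteq> j" for i j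
  proof (rule ccontr)
    assume nz: "J $$ (i, j) \<noteq> 0"
    let ?R = "\<lambda>i. Suc i \<le> n \<and> J $$ (i, Suc i) \<noteq> 0"
    have "?R i" using jordan[of i j] nz that by auto
    \<comment> \<open>The least such index starts its block: column i of \<open>J\<close> has no
      entry off the diagonal, so F_i = c h_i while F_(i+1) = c h_(i+1) + h_i with the same
      c.\<close>
    then obtain i where i: "?R i" and min: "\<And>k. k < i \<Longrightarrow> \<not> ?R k"
      using exists_least_iff[of ?R] by blast
    have J1: "J $$ (i, Suc i) = 1" "J $$ (Suc i, Suc i) = J $$ (i, i)"
      using jordan[of i "Suc i"] i by auto
    have "pdiff i F = (\<Sum>k\<le>n. if k = i then Const (J $$ (i, i)) * pdiff i h else 0)"
      unfolding FJ[OF Suc_leD[OF conjunct1[OF i]]]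
    proof (rule sum.cong[OF refl])
      fix k assume "k \<in> {..n}"
      then have "J $$ (k, i) = 0" if "k \<noteq> i"
        using jordan[of k i] min[of k] i that by force
      then show "Const (J $$ (k, i)) * pdiff k h = (if k = i then Const (J $$ (i, i)) * pdiff i h else 0)"
        by (auto simp: Const_0)
    qed
    then have Fi: "pdiff i F = Const (J $$ (i, i)) * pdiff i h" using i by simp
    have "pdiff (Suc i) F = (\<Sum>k\<le>n. (if k = Suc i then Const (J $$ (i, i)) * pdiff (Suc i) h else 0)
        + (if k = i then pdiff i h else 0))"
      unfolding FJ[OF conjunct1[OF i]]
    proof (rule sum.cong[OF refl])
      fix k assume "k \<in> {..n}"
      then have "J $$ (k, Suc i) = 0" if "k \<noteq> i" "k \<noteq> Suc i"
        using jordan[of k "Suc i"] i that by force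
      then show "Const (J $$ (k, Suc i)) * pdiff k h
        = (if k = Suc i then Const (J $$ (i, i)) * pdiff (Suc i) h else 0) + (if k = i then pdiff i h else 0)"
        by (auto simp: Const_0 Const_1 J1)
    qed
    then have FSi: "pdiff (Suc i) F = Const (J $$ (i, i)) * pdiff (Suc i) h + pdiff i h"
      using i by (simp add: sum.distrib)
    have "pdiff (Suc i) (pdiff i F) = pdiff i (pdiff (Suc i) F)" by (rule pdiff_commute)
    then have "pdiff i (pdiff i h) = 0"
      unfolding Fi FSi pdiff_add pdiff_Const_times pdiff_commute[of "Suc i" i] by simp
    then show False using pure i by simp
  qed
  have Fj: "pdiff j F = Const (J $$ (j, j)) * pdiff j h" if j: "j \<le> n" for j
  proof -
    have "pdiff j F = (\<Sum>k\<le>n. if k = j then Const (J $$ (j, j)) * pdiff j h else 0)"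
      unfolding FJ[OF j] using diag j by (intro sum.cong) (auto simp: Const_0)
    then show ?thesis using j by simp
  qed
  \<comment> \<open>Two groups suffice, so one eigenvalue is separated from all the others together;
    taking that of index 0 makes \<open>S\<close> nonempty.\<close>
  define S where "S = {i. i \<le> n \<and> J $$ (i, i) = J $$ (0, 0)}"
  have S: "S \<subseteq> {..n}" "S \<noteq> {}" by (auto simp: S_def)
  have "S \<noteq> {..n}"
  proof
    assume "S = {..n}"
    then have J0: "J $$ (j, j) = J $$ (0, 0)" if "j \<le> n" for j
      using that unfolding S_def by blast
    have "F = Const (J $$ (0, 0)) * h"
    proof (rule eq_Const_times_of_partials[OF F h])
      show "d \<ge> 1" using assms(2) by simp
      show "pdiff j F = Const (J $$ (0, 0)) * pdiff j h" if "j \<le> n" for j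
        unfolding Fj[OF that] J0[OF that] ..
    qed
    then have "lin_subst Q F = Const (J $$ (0, 0)) * lin_subst Q h"
      by (simp add: lin_subst_def psubst_simps)
    then have "f = psmult (J $$ (0, 0)) g"
      unfolding F_def h_def lin_subst_lin_subst_inverse[OF P Q PQ fp] lin_subst_lin_subst_inverse[OF P Q PQ gp]
      by (simp add: psmult_def)
    \<comment> \<open>Equality of hypersurfaces requires a nonzero scalar; a zero one would force f
      = 0.\<close>
    moreover from this have "J $$ (0, 0) \<noteq> 0" using f(2) by (auto simp: psmult_def Const_0)
    ultimately show False using assms(6) unfolding same_hypersurface_def by blast
  qed
  have "pdiff i (pdiff j h) = 0" if "i \<in> S" "j \<in> {..n} - S" for i j
  proof -
    have ij: "i \<le> n" "j \<le> n" "J $$ (i, i) \<noteq> J $$ (j, j)" using that by (auto simp: S_def)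
    have "pdiff i (pdiff j F) = pdiff j (pdiff i F)" by (rule pdiff_commute)
    then have "Const (J $$ (j, j)) * pdiff i (pdiff j h) = Const (J $$ (i, i)) * pdiff i (pdiff j h)"
      unfolding Fj[OF ij(1)] Fj[OF ij(2)] pdiff_Const_times pdiff_commute[of j i] .
    then have "pdiff i (pdiff j h) = 0 \<or> Const (J $$ (j, j)) = Const (J $$ (i, i))" by simp
    moreover have "Const (J $$ (j, j)) \<noteq> Const (J $$ (i, i))"
      using ij(3) by (metis Const_def lookup_single_eq)
    ultimately show ?thesis by blast
  qed
  then obtain p q where "p \<in> forms S d" "q \<in> forms ({..n} - S) d" "h = p + q"
    by (rule split_of_mixed_partials_zero[OF h])
  then have "sebastiani_thom n d (lin_subst Q h)"
    using sebastiani_thom_of_split[OF P Q PQ QP S \<open>S \<noteq> {..n}\<close>] by simp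
  then show ?thesis
    unfolding h_def lin_subst_lin_subst_inverse[OF P Q PQ gp] .
qed

end
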